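(* A class $\mathcal C$ of finite graphs has bounded expansion if and only if $\mathcal C$ is weakly sparse and has bounded flip-width.
   Context: Graphs are finite, simple, undirected. For a graph $G$ and $r\in\mathbb N$, $\tilde\nabla_r(G)$ is the maximum of $2|E(H)|/|V(H)|$ over graphs $H$ such that some graph obtained from $H$ by replacing every edge by a path of length at most $r+1$ is a subgraph of $G$; $\mathcal C$ has bounded expansion if $\sup_{G\in\mathcal C}\tilde\nabla_r(G)<\infty$ for all $r$. $\mathcal C$ is weakly sparse if for some $t$ no graph in $\mathcal C$ contains $K_{t,t}$ as a subgraph. A $k$-flip of $G$ is obtained by choosing a partition $\mathcal P$ of $V(G)$ with at most $k$ parts and, for some pairs $A,B$ of (possibly equal) parts, inverting adjacency of every pair of distinct $x\in A,y\in B$. Flipper game of radius $r$ and width $k$: $G_0=G$, runner chooses $v_0$; in round $i\ge1$ the flipper announces a $k$-flip $G_i$ of $G$, the runner moves from $v_{i-1}$ to $v_i$ along a path of length at most $r$ in $G_{i-1}$; the flipper wins if $v_i$ is isolated in $G_i$. $\mathrm{fw}_r(G)$ is the least $k$ for which the flipper has a winning strategy; $\mathcal C$ has bounded flip-width if $\sup_{G\in\mathcal C}\mathrm{fw}_r(G)<\infty$ for every $r\in\mathbb N$. *)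

theory Defs
  imports Complex_Main "HOL-Library.Disjoint_Sets"
begin

type_synonym 'a graph = "'a set \<times> 'a set set"

definition wf_graph :: "'a graph \<Rightarrow> bool" where
  "wf_graph G \<longleftrightarrow> finite (fst G) \<and> (\<forall>e\<in>snd G. e \<subseteq> fst G \<and> card e = 2)"

definition adj :: "'a graph \<Rightarrow> 'a \<Rightarrow> 'a \<Rightarrow> bool" where
  "adj G x y \<longleftrightarrow> x \<noteq> y \<and> {x, y} \<in> snd G"

text \<open>p is a path in G from u to v (list of distinct vertices); its length is length p - 1.\<close>
definition is_path :: "'a graph \<Rightarrow> 'a list \<Rightarrow> 'a \<Rightarrow> 'a \<Rightarrow> bool" where
  "is_path G p u v \<longleftrightarrow> p \<noteq> [] \<and> hd p = u \<and> last p = v \<and> distinct p \<and> set p \<subseteq> fst G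
     \<and> (\<forall>i. Suc i < length p \<longrightarrow> adj G (p ! i) (p ! Suc i))"

text \<open>Shallow topological minor at depth r: the graph H with vertex set B (the branch
  vertices, identified with their images in G) and edge set F, such that each edge of H
  is replaced by a path of length at most r+1 in G, these paths being internally
  vertex-disjoint and avoiding the branch vertices in their interiors.\<close>
definition shallow_top_minor :: "'a graph \<Rightarrow> nat \<Rightarrow> 'a set \<Rightarrow> 'a set set \<Rightarrow> bool" where
  "shallow_top_minor G r B F \<longleftrightarrow> B \<subseteq> fst G \<and> (\<forall>e\<in>F. e \<subseteq> B \<and> card e = 2) \<and>
     (\<exists>P :: 'a set \<Rightarrow> 'a list.
        (\<forall>e\<in>F. \<exists>u v. e = {u, v} \<and> is_path G (P e) u v \<and> length (P e) - 1 \<le> r + 1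
                    \<and> (set (P e) - e) \<inter> B = {}) \<and>
        (\<forall>e\<in>F. \<forall>e'\<in>F. e \<noteq> e' \<longrightarrow> (set (P e) - e) \<inter> (set (P e') - e') = {}))"

definition tnabla :: "nat \<Rightarrow> 'a graph \<Rightarrow> real" where
  "tnabla r G = Max {2 * real (card F) / real (card B) | B F. shallow_top_minor G r B F}"

definition bounded_expansion :: "'a graph set \<Rightarrow> bool" where
  "bounded_expansion C \<longleftrightarrow> (\<forall>r. \<exists>c::real. \<forall>G\<in>C. tnabla r G \<le> c)"

definition contains_Ktt :: "'a graph \<Rightarrow> nat \<Rightarrow> bool" where
  "contains_Ktt G t \<longleftrightarrow> (\<exists>A B. A \<subseteq> fst G \<and> B \<subseteq> fst G \<and> A \<inter> B = {} \<and> card A = t \<and> card B = t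
      \<and> (\<forall>a\<in>A. \<forall>b\<in>B. adj G a b))"

definition weakly_sparse :: "'a graph set \<Rightarrow> bool" where
  "weakly_sparse C \<longleftrightarrow> (\<exists>t. \<forall>G\<in>C. \<not> contains_Ktt G t)"

definition is_kflip :: "'a graph \<Rightarrow> nat \<Rightarrow> 'a graph \<Rightarrow> bool" where
  "is_kflip G k H \<longleftrightarrow> fst H = fst G \<and>
     (\<exists>P R. partition_on (fst G) P \<and> card P \<le> k \<and> R \<subseteq> P \<times> P \<and> sym R \<and>
        snd H = {{x, y} | x y. x \<in> fst G \<and> y \<in> fst G \<and> x \<noteq> y \<and>
                   (adj G x y \<noteq> (\<exists>A B. (A, B) \<in> R \<and> x \<in> A \<and> y \<in> B))})"

definition reach_within :: "'a graph \<Rightarrow> 'a \<Rightarrow> 'a \<Rightarrow> nat \<Rightarrow> bool" where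
  "reach_within H v w r \<longleftrightarrow> (\<exists>p. is_path H p v w \<and> length p \<le> Suc r)"

definition isolated :: "'a graph \<Rightarrow> 'a \<Rightarrow> bool" where
  "isolated H v \<longleftrightarrow> \<not> (\<exists>w. adj H v w)"

text \<open>fwin G k r H v: in the flipper game of radius r and width k on G, at a position where
  the current graph is H (= G_{i-1}) and the runner is at v (= v_{i-1}), the flipper
  has a strategy that wins (in finitely many rounds).\<close>
inductive fwin :: "'a graph \<Rightarrow> nat \<Rightarrow> nat \<Rightarrow> 'a graph \<Rightarrow> 'a \<Rightarrow> bool" for G k r where
  "is_kflip G k H' \<Longrightarrow> (\<forall>w. reach_within H v w r \<longrightarrow> isolated H' w \<or> fwin G k r H' w)
     \<Longrightarrow> fwin G k r H v"

definition flipper_wins :: "'a graph \<Rightarrow> nat \<Rightarrow> nat \<Rightarrow> bool" where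
  "flipper_wins G r k \<longleftrightarrow> (\<forall>v0\<in>fst G. fwin G k r G v0)"

definition flip_width :: "nat \<Rightarrow> 'a graph \<Rightarrow> nat" where
  "flip_width r G = (LEAST k. flipper_wins G r k)"

definition bounded_flip_width :: "'a graph set \<Rightarrow> bool" where
  "bounded_flip_width C \<longleftrightarrow> (\<forall>r. \<exists>c. \<forall>G\<in>C. flip_width r G \<le> c)"

end

theory Submission
  imports Defs
begin


text \<open>
  Weakly sparse and bounded flip-width implies bounded expansion: in a graph without \<open>K\<^sub>t\<^sub>,\<^sub>t\<close>, a
  \<open>k\<close>-flip does not hinder the runner more than deleting a set \<open>S\<close> of boundedly many vertices, since
  the ends of a flipped edge outside \<open>S\<close> are still joined by a path of length 3. In a shallow
  topological minor of minimum degree \<open>> 2|S|\<close> the runner can therefore move forever between branch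
  vertices.

  Conversely, bounded expansion yields a linear order of the vertices and for every \<open>v\<close> a small set
  \<open>X v\<close> that meets all short walks from \<open>v\<close> to smaller vertices (a variant of bounded admissibility).
  Iterating \<open>X\<close> from the position of the runner and isolating the resulting set forces the least vertex
  in reach of the runner to increase in every round.
\<close>

section \<open>Walks, flips and widths\<close>

text \<open>Repetitions are allowed so that walks can be concatenated freely; paths are recovered by
  \<open>walk_to_path\<close>.\<close>

definition walk :: "'a graph \<Rightarrow> 'a list \<Rightarrow> 'a \<Rightarrow> 'a \<Rightarrow> bool" where
  "walk G p u v \<longleftrightarrow> p \<noteq> [] \<and> hd p = u \<and> last p = v \<and> set p \<subseteq> fst G \<and> successively (adj G) p"

lemma adj_commute: "adj G x y \<longleftrightarrow> adj G y x"
  by (auto simp: adj_def insert_commute)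

lemma adj_in_verts:
  assumes "wf_graph G" "adj G x y"
  shows "x \<in> fst G" "y \<in> fst G"
  using assms by (auto simp: wf_graph_def adj_def)

lemma successively_conv_nth:
  "successively Q p \<longleftrightarrow> (\<forall>i. Suc i < length p \<longrightarrow> Q (p ! i) (p ! Suc i))"
proof (induction Q p rule: successively.induct)
  case (3 Q x y xs)
  have "(\<forall>i. Suc i < length (x # y # xs) \<longrightarrow> Q ((x # y # xs) ! i) ((x # y # xs) ! Suc i))
    \<longleftrightarrow> Q x y \<and> (\<forall>i. Suc i < length (y # xs) \<longrightarrow> Q ((y # xs) ! i) ((y # xs) ! Suc i))"
    using All_less_Suc2[of "length xs" "\<lambda>i. Q ((x # y # xs) ! i) ((x # y # xs) ! Suc i)"] by simp
  then show ?case using 3 by simp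
qed auto

lemma is_path_iff_walk: "is_path G p u v \<longleftrightarrow> walk G p u v \<and> distinct p"
  by (auto simp: is_path_def walk_def successively_conv_nth)

lemma is_path_ends_in_set: "is_path G p u v \<Longrightarrow> u \<in> set p" "is_path G p u v \<Longrightarrow> v \<in> set p"
  unfolding is_path_def using hd_in_set last_in_set by metis+

lemma walk_single: "x \<in> fst G \<Longrightarrow> walk G [x] x x"
  by (simp add: walk_def)

lemma walk_Cons: "walk G (x # p) u v \<longleftrightarrow>
    x = u \<and> x \<in> fst G \<and> (p = [] \<and> x = v \<or> p \<noteq> [] \<and> adj G x (hd p) \<and> walk G p (hd p) v)"
  by (auto simp: walk_def successively_Cons)

lemma walk_append:
  assumes "walk G p u v" "walk G q v w"
  shows "walk G (p @ tl q) u w"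
proof (cases "tl q")
  case Nil
  then show ?thesis using assms by (cases q) (auto simp: walk_def)
next
  case (Cons y ys)
  then show ?thesis using assms by (cases q) (auto simp: walk_def successively_append_iff)
qed

lemma walk_rev: "walk G p u v \<Longrightarrow> walk G (rev p) v u"
  by (auto simp: walk_def hd_rev last_rev adj_commute)

lemma walk_suffix: "walk G (us @ y # vs) u v \<Longrightarrow> walk G (y # vs) y v"
  by (auto simp: walk_def successively_append_iff)

lemma walk_prefix: "walk G (us @ y # vs) u v \<Longrightarrow> walk G (us @ [y]) u y"
  by (cases us) (auto simp: walk_def successively_append_iff successively_Cons hd_append)

text \<open>The closed piece between two occurrences of a vertex can be cut out. No new vertex
  enters, so whatever the walk avoids the path avoids too.\<close>

lemma walk_to_path:
  assumes "walk G p u v"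
  shows "\<exists>q. is_path G q u v \<and> set q \<subseteq> set p \<and> length q \<le> length p"
  using assms
proof (induction "length p" arbitrary: p rule: less_induct)
  case less
  show ?case
  proof (cases "distinct p")
    case True
    then show ?thesis using less.prems by (intro exI[of _ p]) (simp add: is_path_iff_walk)
  next
    case False
    then obtain xs y ys zs where p: "p = xs @ [y] @ ys @ [y] @ zs"
      using not_distinct_decomp by blast
    have "walk G (xs @ [y]) u y"
      by (rule walk_prefix[of _ xs y "ys @ y # zs" u v]) (use less.prems p in simp)
    moreover have "walk G (y # zs) y v"
      by (rule walk_suffix[of _ "xs @ y # ys" y zs u v]) (use less.prems p in simp)
    ultimately have "walk G ((xs @ [y]) @ tl (y # zs)) u v"
      by (rule walk_append)
    then have "walk G (xs @ y # zs) u v" by simp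
    moreover have "length (xs @ y # zs) < length p" by (simp add: p)
    ultimately obtain q where "is_path G q u v"
      "set q \<subseteq> set (xs @ y # zs)" "length q \<le> length (xs @ y # zs)"
      using less.hyps by metis
    moreover have "set (xs @ y # zs) \<subseteq> set p" "length (xs @ y # zs) \<le> length p"
      by (auto simp: p)
    ultimately show ?thesis by (meson order_trans)
  qed
qed

lemma reach_within_iff_walk: "reach_within H v w r \<longleftrightarrow> (\<exists>p. walk H p v w \<and> length p \<le> Suc r)"
  unfolding reach_within_def using walk_to_path is_path_iff_walk by (meson order_trans)

lemma reach_not_isolated:
  assumes "reach_within H v w r" "v \<noteq> w"
  shows "\<not> isolated H v"
proof -
  obtain p where p: "walk H p v w" using assms reach_within_iff_walk by metis
  show ?thesis
  proof (cases p)
    case (Cons x q)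
    then show ?thesis using p assms by (auto simp: walk_Cons isolated_def)
  qed (use p in \<open>auto simp: walk_def\<close>)
qed

section \<open>Flips and winning strategies of a given width\<close>

lemma is_kflip_mono: "is_kflip G k H \<Longrightarrow> k \<le> l \<Longrightarrow> is_kflip G l H"
  unfolding is_kflip_def by (meson order_trans)

lemma fwin_mono:
  assumes "fwin G k r H v" "k \<le> l"
  shows "fwin G l r H v"
  using assms
proof (induction rule: fwin.induct)
  case (1 H' H v)
  then show ?case by (intro fwin.intros[of G l H']) (auto intro: is_kflip_mono)
qed

lemma flipper_wins_mono: "flipper_wins G r k \<Longrightarrow> k \<le> l \<Longrightarrow> flipper_wins G r l"
  unfolding flipper_wins_def by (metis fwin_mono)

text \<open>Each vertex of \<open>S\<close> forms its own class, the others are classified by their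
  neighbourhood in \<open>S\<close>. Adjacency between a singleton from \<open>S\<close> and any
  other class is then uniform, so flipping the adjacent pairs of this kind deletes exactly the edges
  that meet \<open>S\<close>.\<close>

lemma isolating_flip:
  assumes fin: "finite (fst G)" and S: "S \<subseteq> fst G"
  shows "\<exists>H. is_kflip G (card S + 2 ^ card S) H \<and>
    (\<forall>x y. adj H x y \<longleftrightarrow> x \<in> fst G \<and> y \<in> fst G \<and> adj G x y \<and> x \<notin> S \<and> y \<notin> S)"
proof -
  define V where "V = fst G"
  have finS: "finite S" using fin S finite_subset by blast
  define f where "f = (\<lambda>x. if x \<in> S then Inl x else Inr {z \<in> S. adj G x z})"
  define cls where "cls = (\<lambda>x. {y \<in> V. f y = f x})"
  define P where "P = cls ` V"
  define R where "R = {(A, B). A \<in> P \<and> B \<in> P \<and> (\<exists>a\<in>A. \<exists>b\<in>B. adj G a b \<and> (a \<in> S \<or> b \<in> S))}"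
  define H where "H = (V, {{x, y} | x y. x \<in> V \<and> y \<in> V \<and> x \<noteq> y \<and>
                   (adj G x y \<noteq> (\<exists>A B. (A, B) \<in> R \<and> x \<in> A \<and> y \<in> B))})"
  have part: "partition_on V P"
    by (auto simp: partition_on_def P_def cls_def disjoint_def)
  have "card P \<le> card (f ` V)"
  proof -
    have "P = (\<lambda>t. {y \<in> V. f y = t}) ` (f ` V)" by (auto simp: P_def cls_def)
    then show ?thesis using fin by (simp add: V_def card_image_le)
  qed
  also have "\<dots> \<le> card (S <+> Pow S)"
    by (rule card_mono) (use finS in \<open>auto simp: f_def\<close>)
  also have "\<dots> = card S + 2 ^ card S"
    using finS by (simp add: card_Plus card_Pow)
  finally have cP: "card P \<le> card S + 2 ^ card S" .
  have flip: "(\<exists>A B. (A, B) \<in> R \<and> x \<in> A \<and> y \<in> B) \<longleftrightarrow> adj G x y \<and> (x \<in> S \<or> y \<in> S)"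
    if xy: "x \<in> V" "y \<in> V" "x \<noteq> y" for x y
  proof
    assume "\<exists>A B. (A, B) \<in> R \<and> x \<in> A \<and> y \<in> B"
    then obtain a b where ab: "f a = f x" "f b = f y" "adj G a b" "a \<in> S \<or> b \<in> S"
      unfolding R_def P_def cls_def by auto
    \<comment> \<open>A vertex of \<open>S\<close> is alone in its class, so a witness in
      \<open>S\<close> is the given vertex itself; the other end is compared through its
      neighbourhood in \<open>S\<close>.\<close>
    have 1: "a = x" if "a \<in> S" using ab(1) that by (auto simp: f_def split: if_splits)
    have 2: "b = y" if "b \<in> S" using ab(2) that by (auto simp: f_def split: if_splits)
    show "adj G x y \<and> (x \<in> S \<or> y \<in> S)"
    proof (cases "a \<in> S")
      case aS: True
      then have ax: "a = x" using 1 by simp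
      show ?thesis
      proof (cases "b \<in> S")
        case True
        then show ?thesis using 2 ax aS ab by simp
      next
        case False
        then have "y \<notin> S" "{z \<in> S. adj G b z} = {z \<in> S. adj G y z}"
          using ab(2) by (auto simp: f_def split: if_splits)
        moreover have "adj G b x" using ax ab(3) adj_commute by metis
        ultimately have "adj G y x" using ax aS by blast
        then show ?thesis using ax aS adj_commute by metis
      qed
    next
      case False
      then have bS: "b \<in> S" "b = y" using ab 2 by auto
      have "x \<notin> S" "{z \<in> S. adj G a z} = {z \<in> S. adj G x z}"
        using ab(1) False by (auto simp: f_def split: if_splits)
      then show ?thesis using bS ab(3) by blast
    qed
  next
    assume a: "adj G x y \<and> (x \<in> S \<or> y \<in> S)"
    have "(cls x, cls y) \<in> R"
      using a xy unfolding R_def P_def cls_def by blast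
    then show "\<exists>A B. (A, B) \<in> R \<and> x \<in> A \<and> y \<in> B"
      using xy by (intro exI[of _ "cls x"] exI[of _ "cls y"]) (auto simp: cls_def)
  qed
  have "sym R" unfolding R_def sym_def using adj_commute by fast
  then have "is_kflip G (card S + 2 ^ card S) H"
    unfolding is_kflip_def using part cP
    by (intro conjI exI[of _ P] exI[of _ R]) (auto simp: H_def V_def R_def)
  moreover have "adj H x y \<longleftrightarrow> x \<in> fst G \<and> y \<in> fst G \<and> adj G x y \<and> x \<notin> S \<and> y \<notin> S" for x y
  proof -
    let ?E = "\<lambda>x y. x \<in> V \<and> y \<in> V \<and> adj G x y \<and> x \<notin> S \<and> y \<notin> S"
    have "x' \<in> V \<and> y' \<in> V \<and> x' \<noteq> y' \<and>
        (adj G x' y' \<noteq> (\<exists>A B. (A, B) \<in> R \<and> x' \<in> A \<and> y' \<in> B)) \<longleftrightarrow> ?E x' y'" for x' y'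
      using flip[of x' y'] by (auto simp: adj_def)
    then have "snd H = {{x', y'} | x' y'. ?E x' y'}"
      unfolding H_def snd_conv by simp
    moreover have "{x, y} \<in> {{x', y'} | x' y'. ?E x' y'} \<longleftrightarrow> ?E x y"
      using adj_commute[of G x y] by (auto simp: doubleton_eq_iff)
    ultimately show ?thesis by (auto simp: adj_def V_def)
  qed
  ultimately show ?thesis by blast
qed

text \<open>Isolating all vertices wins in the first round. Hence the minimum that defines
  \<open>flip_width\<close> is attained.\<close>

lemma flipper_wins_exists:
  assumes "finite (fst G)"
  shows "\<exists>k. flipper_wins G r k"
proof -
  define k where "k = card (fst G) + 2 ^ card (fst G)"
  obtain H where H: "is_kflip G k H" "\<forall>x y. \<not> adj H x y"
    using isolating_flip[OF assms order_refl] unfolding k_def by blast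
  have "fwin G k r H' v" for H' v
    by (rule fwin.intros[OF H(1)]) (use H(2) in \<open>auto simp: isolated_def\<close>)
  then show ?thesis unfolding flipper_wins_def by blast
qed

lemma flip_width_le_iff:
  assumes "finite (fst G)"
  shows "flip_width r G \<le> k \<longleftrightarrow> flipper_wins G r k"
proof
  have "flipper_wins G r (flip_width r G)"
    unfolding flip_width_def by (rule LeastI_ex) (rule flipper_wins_exists[OF assms])
  then show "flip_width r G \<le> k \<Longrightarrow> flipper_wins G r k" by (rule flipper_wins_mono)
qed (simp add: flip_width_def Least_le)

section \<open>Shallow topological minors and their densities\<close>

lemma shallow_top_minor_sets:
  assumes "shallow_top_minor G r B F"
  shows "B \<in> Pow (fst G)" "F \<in> Pow (Pow (fst G))"
  using assms unfolding shallow_top_minor_def by auto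

lemma shallow_top_minorE:
  assumes "shallow_top_minor G r B F"
  obtains P where "\<forall>e\<in>F. \<exists>u v. e = {u, v} \<and> is_path G (P e) u v \<and> length (P e) - 1 \<le> r + 1
      \<and> (set (P e) - e) \<inter> B = {}"
    and "\<forall>e\<in>F. \<forall>e'\<in>F. e \<noteq> e' \<longrightarrow> (set (P e) - e) \<inter> (set (P e') - e') = {}"
proof -
  from assms have "\<exists>P. (\<forall>e\<in>F. \<exists>u v. e = {u, v} \<and> is_path G (P e) u v \<and> length (P e) - 1 \<le> r + 1
      \<and> (set (P e) - e) \<inter> B = {}) \<and>
    (\<forall>e\<in>F. \<forall>e'\<in>F. e \<noteq> e' \<longrightarrow> (set (P e) - e) \<inter> (set (P e') - e') = {})"
    unfolding shallow_top_minor_def by (elim conjE)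
  then show thesis by (elim exE conjE) (rule that)
qed

lemma finite_shallow_top_minors:
  assumes "finite (fst G)"
  shows "finite {2 * real (card F) / real (card B) | B F. shallow_top_minor G r B F}"
proof (rule finite_subset)
  show "{2 * real (card F) / real (card B) | B F. shallow_top_minor G r B F}
    \<subseteq> (\<lambda>(B, F). 2 * real (card F) / real (card B)) ` (Pow (fst G) \<times> Pow (Pow (fst G)))"
    using shallow_top_minor_sets by fast
qed (use assms in auto)

lemma tnabla_le_iff:
  assumes "finite (fst G)"
  shows "tnabla r G \<le> c \<longleftrightarrow>
    (\<forall>B F. shallow_top_minor G r B F \<longrightarrow> 2 * real (card F) / real (card B) \<le> c)"
proof -
  \<comment> \<open>The empty minor, of density \<open>0 / 0 = 0\<close>, ensures that the maximum
    is over a nonempty set.\<close>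
  have "shallow_top_minor G r {} {}" by (simp add: shallow_top_minor_def)
  then have ne: "{2 * real (card F) / real (card B) | B F. shallow_top_minor G r B F} \<noteq> {}" by blast
  show ?thesis
    unfolding tnabla_def Max_le_iff[OF finite_shallow_top_minors[OF assms] ne] by blast
qed


section \<open>The runner in dense shallow topological minors\<close>

definition shadows :: "'a graph \<Rightarrow> 'a graph \<Rightarrow> 'a set \<Rightarrow> bool" where
  "shadows H G S \<longleftrightarrow> fst H = fst G \<and>
    (\<forall>x y. adj G x y \<and> x \<notin> S \<and> y \<notin> S \<longrightarrow> (\<exists>p. walk H p x y \<and> length p \<le> 4))"
  \<comment> \<open>\<open>length p\<close> counts vertices, so an edge is replaced by at most 3 edges\<close>

text \<open>Any \<open>t\<close> such vertices would together exclude at most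
  \<open>2 * t * t\<close> non-neighbours and \<open>t\<close> vertices of their own from
  \<open>B\<close>; the remaining \<open>t\<close> vertices would complete a
  \<open>K_{t,t}\<close>.\<close>

lemma few_dominating_vertices:
  assumes noK: "\<not> contains_Ktt G t" and fin: "finite (fst G)" and AB: "A \<subseteq> fst G" "B \<subseteq> fst G"
    and large: "2 * t * t + 2 * t \<le> card B"
  shows "card {x \<in> A. card {y \<in> B. y \<noteq> x \<and> \<not> adj G x y} < 2 * t} < t"
proof (rule ccontr)
  let ?N = "\<lambda>x. {y \<in> B. y \<noteq> x \<and> \<not> adj G x y}"
  assume "\<not> ?thesis"
  then have "t \<le> card {x \<in> A. card (?N x) < 2 * t}" by simp
  then obtain T where T: "T \<subseteq> {x \<in> A. card (?N x) < 2 * t}" "card T = t" "finite T"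
    by (rule obtain_subset_with_card_n)
  have finB: "finite B" using AB fin finite_subset by blast
  have "card (\<Union>x\<in>T. ?N x) \<le> (\<Sum>x\<in>T. card (?N x))"
    using T(3) by (rule card_UN_le)
  also have "\<dots> \<le> (\<Sum>x\<in>T. 2 * t)"
    by (rule sum_mono) (use T in \<open>auto intro: less_imp_le\<close>)
  finally have "card (\<Union>x\<in>T. ?N x) \<le> 2 * t * t" using T(2) by simp
  then have "card (T \<union> (\<Union>x\<in>T. ?N x)) \<le> t + 2 * t * t"
    using card_Un_le[of T "\<Union>x\<in>T. ?N x"] T(2) by linarith
  moreover have "card B - card (T \<union> (\<Union>x\<in>T. ?N x)) \<le> card (B - (T \<union> (\<Union>x\<in>T. ?N x)))"
    by (rule diff_card_le_card_Diff) (use T(3) finB in auto)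
  ultimately have "t \<le> card (B - (T \<union> (\<Union>x\<in>T. ?N x)))" using large by linarith
  then obtain T' where T': "T' \<subseteq> B - (T \<union> (\<Union>x\<in>T. ?N x))" "card T' = t" "finite T'"
    by (rule obtain_subset_with_card_n)
  have "adj G a b" if "a \<in> T" "b \<in> T'" for a b
    using that T' by blast
  moreover have "T \<subseteq> fst G" "T' \<subseteq> fst G" "T \<inter> T' = {}"
    using T(1) T' AB by auto
  ultimately have "contains_Ktt G t"
    unfolding contains_Ktt_def using T(2) T'(2) by blast
  then show False using noK by contradiction
qed

text \<open>In the bound on \<open>card S\<close>, the first summand pays for the parts with at most
  \<open>2 * t * t + 2 * t\<close> vertices, the second for at most \<open>t\<close> exceptional
  vertices per ordered pair of parts.\<close>

lemma kflip_shadows: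
  assumes wf: "wf_graph G" and noK: "\<not> contains_Ktt G t" and flip: "is_kflip G k H"
  shows "\<exists>S. finite S \<and> card S \<le> k * (2 * t * t + 2 * t) + k * k * t \<and> shadows H G S"
proof -
  let ?m = "2 * t * t + 2 * t"
  have fin: "finite (fst G)" using wf by (simp add: wf_graph_def)
  have vH: "fst H = fst G" using flip by (simp add: is_kflip_def)
  obtain P R where P: "partition_on (fst G) P" "card P \<le> k" and R: "R \<subseteq> P \<times> P" "sym R" and
    H: "snd H = {{x, y} | x y. x \<in> fst G \<and> y \<in> fst G \<and> x \<noteq> y \<and>
                   (adj G x y \<noteq> (\<exists>A B. (A, B) \<in> R \<and> x \<in> A \<and> y \<in> B))}"
    using flip unfolding is_kflip_def by meson
  have finP: "finite P" using fin P(1) finite_elements by blast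
  have PV: "A \<subseteq> fst G" if "A \<in> P" for A using that P(1) partition_onD1 by blast
  have Pfin: "finite A" if "A \<in> P" for A using PV[OF that] fin finite_subset by blast
  define miss where "miss = (\<lambda>B x. {y \<in> B. y \<noteq> x \<and> \<not> adj G x y})"
  define bad where "bad = (\<lambda>A B. {x \<in> A. card (miss B x) < 2 * t})"
  define small where "small = {A \<in> P. card A \<le> ?m}"
  define large where "large = {A \<in> P. ?m < card A}"
  \<comment> \<open>Outside \<open>S\<close>, both ends of an edge have many non-neighbours in the opposite part; two of these
    are non-adjacent as there is no \<open>K\<^sub>t\<^sub>,\<^sub>t\<close>, which gives a path of length 3 in the flip.\<close>
  define S where "S = \<Union>small \<union> (\<Union>(A, B)\<in>P \<times> large. bad A B)"
  have "card (\<Union>small) \<le> (\<Sum>A\<in>small. card A)"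
    using card_Union_le_sum_card by simp
  also have "\<dots> \<le> (\<Sum>A\<in>small. ?m)" by (rule sum_mono) (simp add: small_def)
  also have "\<dots> \<le> k * ?m"
    using card_mono[OF finP, of small] P(2) by (simp add: small_def)
  finally have c1: "card (\<Union>small) \<le> k * ?m" .
  have "card (\<Union>(A, B)\<in>P \<times> large. bad A B) \<le> (\<Sum>(A, B)\<in>P \<times> large. card (bad A B))"
    using card_UN_le[of "P \<times> large" "\<lambda>(A, B). bad A B"] finP
    by (simp add: large_def case_prod_unfold)
  also have "\<dots> \<le> (\<Sum>(A, B)\<in>P \<times> large. t)"
  proof (rule sum_mono, clarify)
    fix A B assume "A \<in> P" "B \<in> large"
    then show "card (bad A B) \<le> t"
      using few_dominating_vertices[OF noK fin PV PV, of A B]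
      by (simp add: bad_def miss_def large_def)
  qed
  also have "\<dots> = card P * card large * t"
    by (simp add: case_prod_unfold card_cartesian_product)
  also have "\<dots> \<le> k * k * t"
    using card_mono[OF finP, of large] P(2)
    by (intro mult_le_mono) (auto simp: large_def)
  finally have c2: "card (\<Union>(A, B)\<in>P \<times> large. bad A B) \<le> k * k * t" .
  have "card S \<le> k * ?m + k * k * t"
    unfolding S_def using card_Un_le c1 c2 by (meson add_mono order_trans)
  moreover have "S \<subseteq> fst G" unfolding S_def small_def bad_def using PV by fastforce
  then have "finite S" using fin finite_subset by blast
  moreover have "\<exists>p. walk H p u v \<and> length p \<le> 4"
    if uv: "adj G u v" "u \<notin> S" "v \<notin> S" for u v
  proof -
    have V: "u \<in> fst G" "v \<in> fst G" "u \<noteq> v"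
      using adj_in_verts[OF wf uv(1)] uv(1) by (auto simp: adj_def)
    show ?thesis
    proof (cases "\<exists>A B. (A, B) \<in> R \<and> u \<in> A \<and> v \<in> B")
      case False
      then have "{u, v} \<in> snd H" unfolding H using V uv(1) by blast
      then have "walk H [u, v] u v" using V vH by (simp add: walk_def adj_def)
      then show ?thesis by (intro exI[of _ "[u, v]"]) simp
    next
      case True
      then obtain A B where AB: "(A, B) \<in> R" "u \<in> A" "v \<in> B" by blast
      then have inP: "A \<in> P" "B \<in> P" using R by auto
      have "A \<in> large" "B \<in> large"
        using uv AB inP by (auto simp: S_def small_def large_def not_le)
      \<comment> \<open>The parts \<open>A\<close> and \<open>B\<close> may coincide. With
        \<open>2 * t\<close> non-neighbours available, \<open>t\<close> remain for \<open>T1\<close>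
        after those in \<open>T2\<close> are discarded.\<close>
      then have "2 * t \<le> card (miss B u)" "2 * t \<le> card (miss A v)"
        using uv AB inP by (auto simp: S_def bad_def not_less)
      then have "t \<le> card (miss A v)" by simp
      then obtain T2 where T2: "T2 \<subseteq> miss A v" "card T2 = t" "finite T2"
        by (rule obtain_subset_with_card_n)
      have "finite (miss B u)" using Pfin[OF inP(2)] by (simp add: miss_def)
      then have "card (miss B u) - card T2 \<le> card (miss B u - T2)"
        using T2 diff_card_le_card_Diff by blast
      then have "t \<le> card (miss B u - T2)" using T2 \<open>2 * t \<le> card (miss B u)\<close> by linarith
      then obtain T1 where T1: "T1 \<subseteq> miss B u - T2" "card T1 = t" "finite T1"
        by (rule obtain_subset_with_card_n)
      have "T1 \<subseteq> fst G" "T2 \<subseteq> fst G" "T1 \<inter> T2 = {}"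
        using T1 T2 PV inP by (auto simp: miss_def)
      then obtain b a where ab: "b \<in> T1" "a \<in> T2" "\<not> adj G b a"
        using noK T1(2) T2(2) unfolding contains_Ktt_def by metis
      have b: "b \<in> B" "b \<noteq> u" "\<not> adj G u b" "b \<noteq> a" using ab T1 by (auto simp: miss_def)
      have a: "a \<in> A" "a \<noteq> v" "\<not> adj G v a" using ab T2 by (auto simp: miss_def)
      have flipped: "adj H x y" if "x \<in> A" "y \<in> B" "x \<noteq> y" "\<not> adj G x y" for x y
      proof -
        have "{x, y} \<in> snd H" unfolding H using that AB(1) PV inP by blast
        then show ?thesis using that by (simp add: adj_def)
      qed
      \<comment> \<open>All three pairs are non-edges of \<open>G\<close> between the flipped parts
        \<open>A\<close> and \<open>B\<close>, hence edges of \<open>H\<close>.\<close>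
      have "adj H u b" "adj H a b" "adj H a v"
        using flipped a b AB ab adj_commute by metis+
      then have "adj H u b" "adj H b a" "adj H a v"
        using adj_commute by metis+
      then have "walk H [u, b, a, v] u v"
        using V vH a b PV inP by (auto simp: walk_def)
      then show ?thesis by (intro exI[of _ "[u, b, a, v]"]) simp
    qed
  qed
  ultimately show ?thesis unfolding shadows_def using vH by blast
qed

text \<open>Every edge is replaced by at most 3 edges. Lengths of lists count vertices, which
  explains the shifts by 1.\<close>

lemma shadows_walk:
  assumes "shadows H G S" "walk G p u v" "set p \<inter> S = {}"
  shows "\<exists>q. walk H q u v \<and> length q \<le> 3 * (length p - 1) + 1"
  using assms(2,3)
proof (induction p arbitrary: u)
  case (Cons x p)
  show ?case
  proof (cases "p = []")
    case True
    then show ?thesis using Cons assms(1)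
      by (intro exI[of _ "[u]"]) (auto simp: walk_def shadows_def)
  next
    case False
    then have "hd p \<notin> S"
      using Cons.prems(2) by (metis disjoint_iff hd_in_set list.set_intros(2))
    then have p: "x = u" "adj G u (hd p)" "walk G p (hd p) v" "hd p \<notin> S" "u \<notin> S"
      using False Cons.prems by (auto simp: walk_Cons)
    then obtain q where q: "walk H q (hd p) v" "length q \<le> 3 * (length p - 1) + 1"
      using Cons.IH Cons.prems by auto
    obtain q' where q': "walk H q' u (hd p)" "length q' \<le> 4"
      using assms(1) p unfolding shadows_def by blast
    have "walk H (q' @ tl q) u v" using walk_append[OF q'(1) q(1)] .
    moreover have "length (q' @ tl q) \<le> 3 * (length (x # p) - 1) + 1"
      using q(2) q'(2) False by (cases p) auto
    ultimately show ?thesis by blast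
  qed
qed (simp add: walk_def)

text \<open>Removing a vertex of degree at most \<open>d\<close> costs at most \<open>d\<close>
  edges, so the inequality between edges and vertices survives. It fails for the empty set, so the
  removal stops at a nonempty set.\<close>

lemma min_degree_subgraph:
  assumes "finite B" "\<forall>e\<in>F. e \<subseteq> B \<and> card e = 2" "d * card B < card F"
  shows "\<exists>B' \<subseteq> B. B' \<noteq> {} \<and> (\<forall>v\<in>B'. d < card {e \<in> F. e \<subseteq> B' \<and> v \<in> e})"
  using assms
proof (induction "card B" arbitrary: B F rule: less_induct)
  case less
  have finF: "finite F"
    using less.prems by (intro finite_subset[of F "Pow B"]) auto
  show ?case
  proof (cases "\<forall>v\<in>B. d < card {e \<in> F. v \<in> e}")
    case True
    have "F \<noteq> {}" using less.prems(3) by auto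
    then have "B \<noteq> {}" using less.prems(2) by fastforce
    moreover have "{e \<in> F. e \<subseteq> B \<and> v \<in> e} = {e \<in> F. v \<in> e}" for v
      using less.prems(2) by auto
    ultimately show ?thesis using True by (intro exI[of _ B]) auto
  next
    case False
    then obtain v where v: "v \<in> B" "card {e \<in> F. v \<in> e} \<le> d" by (auto simp: not_less)
    let ?F = "{e \<in> F. v \<notin> e}"
    have "card F = card ({e \<in> F. v \<in> e} \<union> ?F)" by (rule arg_cong[of _ _ card]) auto
    also have "\<dots> = card {e \<in> F. v \<in> e} + card ?F"
      by (rule card_Un_disjoint) (use finF in auto)
    finally have "card F \<le> d + card ?F" using v(2) by simp
    moreover have cB: "card B = Suc (card (B - {v}))"
      using v(1) less.prems(1) by (metis card.remove)
    ultimately have "d * card (B - {v}) < card ?F" using less.prems(3) by simp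
    moreover have "\<forall>e\<in>?F. e \<subseteq> B - {v} \<and> card e = 2" using less.prems(2) by auto
    ultimately obtain B' where B': "B' \<subseteq> B - {v}" "B' \<noteq> {}"
      "\<forall>w\<in>B'. d < card {e \<in> ?F. e \<subseteq> B' \<and> w \<in> e}"
      using less.hyps[of "B - {v}" ?F] cB less.prems(1) by auto
    have "{e \<in> ?F. e \<subseteq> B' \<and> w \<in> e} = {e \<in> F. e \<subseteq> B' \<and> w \<in> e}" for w
      using B'(1) by auto
    then show ?thesis using B' by (intro exI[of _ B']) auto
  qed
qed

text \<open>Pigeonhole: otherwise choosing a point of each \<open>A e\<close> in \<open>T\<close>
  would inject \<open>E\<close> into \<open>T\<close>.\<close>

lemma disjoint_family_avoids:
  assumes "finite T" "finite E" "card T < card E"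
    and disj: "\<And>e e'. e \<in> E \<Longrightarrow> e' \<in> E \<Longrightarrow> e \<noteq> e' \<Longrightarrow> A e \<inter> A e' = {}"
  shows "\<exists>e\<in>E. A e \<inter> T = {}"
proof (rule ccontr)
  assume "\<not> ?thesis"
  then have "\<forall>e\<in>E. \<exists>x. x \<in> A e \<inter> T" by blast
  then obtain f where f: "\<forall>e\<in>E. f e \<in> A e \<inter> T" by metis
  have "inj_on f E"
  proof (rule inj_onI)
    fix e e' assume ee: "e \<in> E" "e' \<in> E" "f e = f e'"
    then have "f e \<in> A e \<inter> A e'" using f by (metis IntD1 IntI)
    then show "e = e'" using disj[OF ee(1,2)] by auto
  qed
  moreover have "f ` E \<subseteq> T" using f by auto
  ultimately have "card E \<le> card T" using assms(1) card_inj_on_le by blast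
  then show False using assms(3) by simp
qed

text \<open>The runner stays in a set \<open>B'\<close> of branch vertices with minimum degree above
  \<open>2 * s\<close>. The current flip and the announced one obstruct at most \<open>s\<close>
  vertices each, so one of the paths to neighbouring branch vertices is free of both. Its at most
  \<open>r + 1\<close> edges become at most \<open>3 * (r + 1)\<close> edges of the flip.\<close>

lemma runner_survives:
  assumes wf: "wf_graph G" and noK: "\<not> contains_Ktt G t"
    and s: "s = k * (2 * t * t + 2 * t) + k * k * t"
    and minor: "shallow_top_minor G r B F" and dense: "2 * s * card B < card F"
  shows "\<not> flipper_wins G (3 * (r + 1)) k"
proof
  assume win: "flipper_wins G (3 * (r + 1)) k"
  have F: "B \<subseteq> fst G" "\<forall>e\<in>F. e \<subseteq> B \<and> card e = 2"
    using minor by (auto simp: shallow_top_minor_def)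
  obtain P where P: "\<forall>e\<in>F. \<exists>u v. e = {u, v} \<and> is_path G (P e) u v \<and> length (P e) - 1 \<le> r + 1
                    \<and> (set (P e) - e) \<inter> B = {}"
    and disj: "\<forall>e\<in>F. \<forall>e'\<in>F. e \<noteq> e' \<longrightarrow> (set (P e) - e) \<inter> (set (P e') - e') = {}"
    using minor by (rule shallow_top_minorE)
  have "finite B" using F(1) wf finite_subset by (auto simp: wf_graph_def)
  then obtain B' where B': "B' \<subseteq> B" "B' \<noteq> {}"
    "\<forall>v\<in>B'. 2 * s < card {e \<in> F. e \<subseteq> B' \<and> v \<in> e}"
    using min_degree_subgraph[OF _ F(2) dense] by blast
  have finF: "finite F" using \<open>finite B\<close> F(2) by (intro finite_subset[of F "Pow B"]) auto
  have escape: "\<exists>w p. w \<in> B' \<and> w \<noteq> v \<and> w \<notin> S \<and> w \<notin> S' \<and>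
      walk G p v w \<and> set p \<inter> S = {} \<and> length p \<le> r + 2"
    if v: "v \<in> B'" "v \<notin> S" and S: "finite S" "card S \<le> s" "finite S'" "card S' \<le> s" for v S S'
  proof -
    let ?E = "{e \<in> F. e \<subseteq> B' \<and> v \<in> e}"
    have "card (S \<union> S') \<le> 2 * s" using S card_Un_le[of S S'] by linarith
    then have "card (S \<union> S') < card ?E" using B'(3) v(1) by fastforce
    \<comment> \<open>Two paths at \<open>v\<close> meet only in \<open>v\<close>: their interiors
      are disjoint and avoid \<open>B\<close>, and their far ends are distinct branch
      vertices.\<close>
    moreover have "(set (P e) \<union> e - {v}) \<inter> (set (P e') \<union> e' - {v}) = {}"
      if e: "e \<in> ?E" "e' \<in> ?E" "e \<noteq> e'" for e e'
    proof -
      have "card e = 2" "card e' = 2" using e F by auto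
      then obtain x y where xy: "e = {v, x}" "e' = {v, y}" using e by (auto simp: card_2_iff)
      have "(set (P e) - e) \<inter> B = {}" "(set (P e') - e') \<inter> B = {}" using P e by auto
      moreover have "e \<subseteq> B" "e' \<subseteq> B" using F(2) e by auto
      moreover have "(set (P e) - e) \<inter> (set (P e') - e') = {}" using disj e by simp
      moreover have "x \<noteq> y" using e(3) xy by blast
      ultimately show ?thesis using xy by auto
    qed
    ultimately obtain e where e: "e \<in> ?E" "(set (P e) \<union> e - {v}) \<inter> (S \<union> S') = {}"
      using disjoint_family_avoids[of "S \<union> S'" ?E "\<lambda>e. set (P e) \<union> e - {v}"] S finF by auto
    obtain a b where ab: "e = {a, b}" "is_path G (P e) a b" "length (P e) - 1 \<le> r + 1"
      using P e(1) by (metis (no_types, lifting) mem_Collect_eq)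
    have wk: "walk G (P e) a b" using ab(2) by (simp add: is_path_iff_walk)
    have "a \<noteq> b" using F(2) e(1) ab(1) by auto
    have avoid: "set (P e) \<inter> S = {}" using e(2) v(2) by blast
    \<comment> \<open>The path chosen for \<open>e\<close> may begin at either end and is reversed
      if necessary.\<close>
    have "v = a \<or> v = b" using e(1) ab(1) by auto
    then obtain w p where "w \<in> e" "w \<noteq> v" "walk G p v w" "set p = set (P e)" "length p = length (P e)"
      using wk walk_rev[OF wk] ab(1) \<open>a \<noteq> b\<close> by (metis insertCI length_rev set_rev)
    then show ?thesis using e ab(3) avoid by (intro exI[of _ w] exI[of _ p]) auto
  qed
  have escape_reach: "\<exists>w. w \<in> B' \<and> w \<noteq> v \<and> w \<notin> S' \<and> reach_within H v w (3 * (r + 1))"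
    if v: "v \<in> B'" "v \<notin> S" and S: "finite S" "card S \<le> s" "finite S'" "card S' \<le> s"
      and H: "shadows H G S" for v S S' H
  proof -
    obtain w p where w: "w \<in> B'" "w \<noteq> v" "w \<notin> S'" "walk G p v w" "set p \<inter> S = {}" "length p \<le> r + 2"
      using escape[OF v S] by blast
    obtain q where "walk H q v w" "length q \<le> 3 * (length p - 1) + 1"
      using shadows_walk[OF H w(4,5)] by blast
    moreover have "3 * (length p - 1) + 1 \<le> Suc (3 * (r + 1))" using w(6) by simp
    ultimately show ?thesis using w reach_within_iff_walk by (metis order_trans)
  qed
  \<comment> \<open>Invariant of the game: the runner stands in \<open>B'\<close> outside a set
    \<open>S\<close> of at most \<open>s\<close> vertices, and the current graph shadows
    \<open>G\<close> outside \<open>S\<close>.\<close>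
  have survive: False
    if "fwin G k (3 * (r + 1)) H v" "shadows H G S" "finite S" "card S \<le> s" "v \<in> B'" "v \<notin> S" for H v S
    using that
  proof (induction arbitrary: S rule: fwin.induct)
    case (1 H' H v)
    obtain S' where S': "finite S'" "card S' \<le> s" "shadows H' G S'"
      using kflip_shadows[OF wf noK 1(1)] s by blast
    obtain w where w: "w \<in> B'" "w \<notin> S'" "reach_within H v w (3 * (r + 1))"
      using escape_reach[OF 1(6,7,4,5) S'(1,2) 1(3)] by blast
    \<comment> \<open>A possible further move in \<open>H'\<close> shows that \<open>w\<close> is
      not isolated there, so the induction hypothesis applies at \<open>w\<close>.\<close>
    obtain w' where w': "w' \<noteq> w" "reach_within H' w w' (3 * (r + 1))"
      using escape_reach[OF w(1,2) S'(1,2) S'(1,2) S'(3)] by blast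
    then have "\<not> isolated H' w" using reach_not_isolated by metis
    then show False using 1(2) w S' by blast
  qed
  obtain v where v: "v \<in> B'" using B'(2) by blast
  then have "fwin G k (3 * (r + 1)) G v" using win F(1) B'(1) unfolding flipper_wins_def by blast
  moreover have "shadows G G {}"
    unfolding shadows_def
  proof (intro conjI refl allI impI)
    fix x y assume "adj G x y \<and> x \<notin> {} \<and> y \<notin> {}"
    then have "walk G [x, y] x y" using adj_in_verts[OF wf] by (auto simp: walk_def)
    then show "\<exists>p. walk G p x y \<and> length p \<le> 4" by (intro exI[of _ "[x, y]"]) simp
  qed
  ultimately show False using survive v by fastforce
qed

lemma bounded_expansion_if_bounded_flip_width:
  assumes wf: "\<forall>G\<in>C. wf_graph G" and "weakly_sparse C" "bounded_flip_width C"
  shows "bounded_expansion C"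
  unfolding bounded_expansion_def
proof
  fix r
  obtain t where t: "\<forall>G\<in>C. \<not> contains_Ktt G t" using assms(2) unfolding weakly_sparse_def by blast
  obtain k where k: "\<forall>G\<in>C. flip_width (3 * (r + 1)) G \<le> k"
    using assms(3) unfolding bounded_flip_width_def by blast
  define s where "s = k * (2 * t * t + 2 * t) + k * k * t"
  have "tnabla r G \<le> 4 * real s" if G: "G \<in> C" for G
  proof -
    have fin: "finite (fst G)" using wf G by (auto simp: wf_graph_def)
    have "2 * real (card F) / real (card B) \<le> 4 * real s" if BF: "shallow_top_minor G r B F" for B F
    proof (rule ccontr)
      assume neg: "\<not> ?thesis"
      \<comment> \<open>For an empty branch set the quotient is 0 by convention and cannot exceed
        the bound.\<close>
      have "card B \<noteq> 0"
      proof
        assume "card B = 0"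
        with neg show False by simp
      qed
      then have "4 * real s * real (card B) < 2 * real (card F)" using neg by (simp add: field_simps)
      then have "real (4 * s * card B) < real (2 * card F)" by simp
      then have "2 * s * card B < card F" by linarith
      then have "\<not> flipper_wins G (3 * (r + 1)) k"
        using runner_survives[OF _ _ s_def BF] wf t G by blast
      then show False using k G flip_width_le_iff[OF fin] by metis
    qed
    then show ?thesis by (simp add: tnabla_le_iff[OF fin])
  qed
  then show "\<exists>c. \<forall>G\<in>C. tnabla r G \<le> c" by blast
qed


section \<open>The flipper in graphs with hitting sets\<close>

text \<open>As with degeneracy orders, the order is built from the top: a vertex chosen in the whole
  set becomes the greatest, and the rest is ordered recursively.\<close>

lemma ranking_by_minimal_choice:
  assumes "finite V"
    and "\<And>S. S \<subseteq> V \<Longrightarrow> S \<noteq> {} \<Longrightarrow> \<exists>v\<in>S. Q S v"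
  shows "\<exists>rk :: 'a \<Rightarrow> nat. inj_on rk V \<and> (\<forall>v\<in>V. Q {u \<in> V. rk u \<le> rk v} v)"
  using assms
proof (induction "card V" arbitrary: V)
  case 0
  then show ?case by auto
next
  case (Suc n)
  then have "V \<noteq> {}" by auto
  then obtain v where v: "v \<in> V" "Q V v" using Suc.prems(2)[of V] by blast
  have "n = card (V - {v})" using v Suc by simp
  moreover have "finite (V - {v})" using Suc.prems(1) by simp
  moreover have "\<exists>v\<in>S. Q S v" if "S \<subseteq> V - {v}" "S \<noteq> {}" for S
    by (rule Suc.prems(2)) (use that in auto)
  ultimately obtain rk :: "'a \<Rightarrow> nat" where rk: "inj_on rk (V - {v})"
    "\<forall>w\<in>V - {v}. Q {u \<in> V - {v}. rk u \<le> rk w} w"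
    using Suc.hyps(1)[of "V - {v}"] by auto
  \<comment> \<open>The added 0 keeps the maximum meaningful when \<open>v\<close> is the only
    vertex.\<close>
  define N where "N = Suc (Max (rk ` (V - {v}) \<union> {0}))"
  have N: "rk w < N" if "w \<in> V - {v}" for w
    unfolding N_def less_Suc_eq_le using that Suc.prems(1) by (intro Max_ge) auto
  define rk' where "rk' = rk(v := N)"
  have "inj_on rk' V"
    using rk(1) N by (auto simp: inj_on_def rk'_def)
  moreover have "Q {u \<in> V. rk' u \<le> rk' w} w" if w: "w \<in> V" for w
  proof (cases "w = v")
    case True
    then have "{u \<in> V. rk' u \<le> rk' w} = V" using N by (auto simp: rk'_def less_imp_le)
    then show ?thesis using v True by simp
  next
    case False
    then have "{u \<in> V. rk' u \<le> rk' w} = {u \<in> V - {v}. rk u \<le> rk w}"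
      using N[of w] w by (auto simp: rk'_def)
    then show ?thesis using rk(2) w False by simp
  qed
  ultimately show ?case by blast
qed

section \<open>Iterated hulls and the strategy of the flipper\<close>

primrec iter_hull :: "('a \<Rightarrow> 'a set) \<Rightarrow> 'a \<Rightarrow> nat \<Rightarrow> 'a set" where
  "iter_hull X v 0 = {v}"
| "iter_hull X v (Suc j) = iter_hull X v j \<union> (\<Union>y\<in>iter_hull X v j. X y)"

lemma iter_hull_mono: "i \<le> j \<Longrightarrow> iter_hull X v i \<subseteq> iter_hull X v j"
  by (rule lift_Suc_mono_le) auto

lemma iter_hull_bounds:
  assumes "v \<in> V" "\<forall>y\<in>V. finite (X y) \<and> X y \<subseteq> V \<and> card (X y) \<le> K"
  shows "iter_hull X v j \<subseteq> V \<and> finite (iter_hull X v j) \<and> card (iter_hull X v j) \<le> Suc K ^ j"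
proof (induction j)
  case (Suc j)
  let ?Y = "iter_hull X v j"
  have "card (\<Union>y\<in>?Y. X y) \<le> (\<Sum>y\<in>?Y. card (X y))" using Suc by (intro card_UN_le) simp
  also have "\<dots> \<le> (\<Sum>y\<in>?Y. K)" using Suc assms(2) by (intro sum_mono) auto
  finally have "card (iter_hull X v (Suc j)) \<le> card ?Y + card ?Y * K"
    using card_Un_le[of ?Y "\<Union>y\<in>?Y. X y"] by simp
  also have "\<dots> \<le> Suc K ^ Suc j"
    using Suc by (metis mult_Suc_right mult_le_mono1 power_Suc2)
  finally show ?case using Suc assms(2) by auto
qed (use assms in auto)

text \<open>The flipper isolates the hull \<open>S v\<close> of the position \<open>v\<close>. If
  the runner goes from \<open>v\<close> to \<open>w\<close> and can then reach \<open>x\<close>,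
  some vertex on the way to \<open>w\<close> is smaller than \<open>x\<close>. So the least rank
  within reach, \<open>low\<close>, grows in each round, and it is bounded.\<close>

lemma flipper_wins_if_hitting_sets:
  fixes rk :: "'a \<Rightarrow> nat"
  assumes wf: "wf_graph G" and inj: "inj_on rk (fst G)"
    and X: "\<forall>v\<in>fst G. finite (X v) \<and> card (X v) \<le> K \<and> X v \<subseteq> fst G \<and> v \<notin> X v"
    and hit: "\<And>v u p. walk G p v u \<Longrightarrow> length p \<le> 2 * r + 1 \<Longrightarrow> rk u < rk v \<Longrightarrow> set p \<inter> X v \<noteq> {}"
  shows "flipper_wins G r (Suc K ^ Suc r + 2 ^ (Suc K ^ Suc r))"
proof -
  let ?V = "fst G" and ?k = "Suc K ^ Suc r + 2 ^ (Suc K ^ Suc r)"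
  have fin: "finite ?V" using wf by (simp add: wf_graph_def)
  define S where "S = (\<lambda>v. iter_hull X v (Suc r))"
  have S: "S v \<subseteq> ?V" "card (S v) \<le> Suc K ^ Suc r" if "v \<in> ?V" for v
    using iter_hull_bounds[OF that, of X K "Suc r"] X unfolding S_def by blast+
  define low where "low = (\<lambda>H v. Min (rk ` {w. reach_within H v w r}))"
  have reach_fin: "finite {w. reach_within H v w r}" if "fst H = ?V" for H v
    using that fin by (auto simp: reach_within_def is_path_def intro!: finite_subset[OF _ fin])
  have pushed: "\<exists>y\<in>set p1. rk y < rk x"
    if v: "v \<in> ?V" and p1: "walk G p1 v w" "length p1 \<le> Suc r"
      and p2: "walk G p2 w x" "length p2 \<le> Suc r" "set p2 \<inter> S v = {}" for v w x p1 p2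
  proof (rule ccontr)
    assume neg: "\<not> ?thesis"
    have xp: "x \<in> set p2" using p2(1) by (auto simp: walk_def)
    have xS: "x \<notin> S v" using xp p2(3) by blast
    have xV: "x \<in> ?V" using xp p2(1) by (auto simp: walk_def)
    \<comment> \<open>If no vertex of \<open>p1\<close> is smaller than \<open>x\<close>, each
      \<open>y\<close> found is greater than \<open>x\<close>, and \<open>X y\<close> meets the walk
      from \<open>y\<close> to \<open>x\<close>. It cannot do so on \<open>p2\<close>, which avoids
      \<open>S v\<close>, hence it does so further along \<open>p1\<close>. After
      \<open>r + 1\<close> such steps \<open>p1\<close> is too short.\<close>
    have "\<exists>us y vs. p1 = us @ y # vs \<and> j \<le> length us \<and> y \<in> iter_hull X v j" if "j \<le> Suc r" for j
      using that
    proof (induction j)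
      case 0
      then show ?case using p1(1) by (intro exI[of _ "[]"] exI[of _ v] exI[of _ "tl p1"]) (auto simp: walk_def)
    next
      case (Suc j)
      then obtain us y vs where d: "p1 = us @ y # vs" "j \<le> length us" "y \<in> iter_hull X v j" by auto
      have yS: "y \<in> S v" using d(3) iter_hull_mono[of j "Suc r" X v] Suc.prems unfolding S_def by auto
      have yV: "y \<in> ?V" using p1(1) d(1) by (auto simp: walk_def)
      have "y \<noteq> x" using xS yS by blast
      then have "rk y \<noteq> rk x" using inj yV xV by (auto dest: inj_onD)
      moreover have "\<not> rk y < rk x" using neg d(1) by auto
      ultimately have lt: "rk x < rk y" by simp
      have "walk G (y # vs) y w" using p1(1) walk_suffix d(1) by fast
      then have wk: "walk G ((y # vs) @ tl p2) y x" using walk_append p2(1) by fast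
      \<comment> \<open>Both walks have at most \<open>r + 1\<close> vertices and share
        \<open>w\<close>.\<close>
      have "length ((y # vs) @ tl p2) \<le> 2 * r + 1" using p1(2) p2(2) d(1) by simp
      then obtain z where z: "z \<in> set ((y # vs) @ tl p2)" "z \<in> X y"
        using hit[OF wk _ lt] by blast
      have "z \<noteq> y" using z(2) X yV by blast
      have zY: "z \<in> iter_hull X v (Suc j)" using z(2) d(3) by auto
      then have "z \<in> S v" using iter_hull_mono[of "Suc j" "Suc r" X v] Suc.prems unfolding S_def by blast
      then have "z \<notin> set p2" using p2(3) by blast
      then have "z \<notin> set (tl p2)" by (cases p2) auto
      then have "z \<in> set vs" using z(1) \<open>z \<noteq> y\<close> by simp
      then obtain us' vs' where "vs = us' @ z # vs'" by (meson split_list)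
      then have "p1 = (us @ y # us') @ z # vs'" "Suc j \<le> length (us @ y # us')" using d by auto
      then show ?case using zY by blast
    qed
    from this[of "Suc r"] show False using p1(2) by auto
  qed
  \<comment> \<open>The flipper only ever announces graphs obtained from \<open>G\<close> by
    deleting edges, so the claim is proved for all such \<open>H\<close>.\<close>
  have "fwin G ?k r H v"
    if "fst H = ?V" "\<forall>x y. adj H x y \<longrightarrow> adj G x y" "v \<in> ?V" for H v
    using that
  proof (induction "Max (insert 0 (rk ` ?V)) - low H v" arbitrary: H v rule: less_induct)
    case less
    obtain H' where H': "is_kflip G (card (S v) + 2 ^ card (S v)) H'"
      "\<forall>x y. adj H' x y \<longleftrightarrow> x \<in> ?V \<and> y \<in> ?V \<and> adj G x y \<and> x \<notin> S v \<and> y \<notin> S v"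
      using isolating_flip[OF fin S(1)[OF less.prems(3)]] by blast
    have "card (S v) + 2 ^ card (S v) \<le> ?k"
      by (intro add_mono power_increasing S(2) less.prems(3)) simp
    then have flip: "is_kflip G ?k H'" using H'(1) is_kflip_mono by blast
    have vH': "fst H' = ?V" using H'(1) by (simp add: is_kflip_def)
    have sub: "walk G p a b" if "walk K p a b" "fst K = ?V" "\<forall>x y. adj K x y \<longrightarrow> adj G x y" for K p a b
      using that unfolding walk_def by (metis successively_mono)
    show ?case
    proof (rule fwin.intros[OF flip], intro allI impI)
      fix w assume "reach_within H v w r"
      then obtain p1 where p1: "walk H p1 v w" "length p1 \<le> Suc r"
        unfolding reach_within_iff_walk by blast
      have wV: "w \<in> ?V" using p1(1) less.prems(1) by (auto simp: walk_def)
      show "isolated H' w \<or> fwin G ?k r H' w"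
      proof (cases "w \<in> S v")
        case True
        then show ?thesis using H'(2) by (simp add: isolated_def)
      next
        case False
        have lower: "low H v < rk x" if "reach_within H' w x r" for x
        proof -
          obtain p2 where p2: "walk H' p2 w x" "length p2 \<le> Suc r"
            using \<open>reach_within H' w x r\<close> unfolding reach_within_iff_walk by blast
          \<comment> \<open>Vertices of \<open>S v\<close> are isolated in \<open>H'\<close>, so a
            walk that starts outside never enters.\<close>
          have "set p2 \<inter> S v = {}"
          proof -
            have "\<forall>w. walk H' p w x \<and> w \<notin> S v \<longrightarrow> set p \<inter> S v = {}" for p
              by (induction p) (use H'(2) in \<open>auto simp: walk_Cons\<close>)
            then show ?thesis using p2(1) False by blast
          qed
          moreover have "walk G p1 v w" using sub p1(1) less.prems by blast
          moreover have "walk G p2 w x" using sub p2(1) vH' H'(2) by blast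
          ultimately obtain y where y: "y \<in> set p1" "rk y < rk x"
            using pushed[OF less.prems(3) _ p1(2) _ p2(2)] by blast
          obtain us vs where "p1 = us @ y # vs" using y(1) by (meson split_list)
          \<comment> \<open>The smaller vertex \<open>y\<close> lies on the runner's own move, so it
            was already within reach from \<open>v\<close>.\<close>
          then have "walk H (us @ [y]) v y" "length (us @ [y]) \<le> Suc r"
            using p1 walk_prefix by fastforce+
          then have "reach_within H v y r" unfolding reach_within_iff_walk by blast
          then have "low H v \<le> rk y" unfolding low_def
            using reach_fin[OF less.prems(1)] by (intro Min_le) auto
          then show ?thesis using y(2) by simp
        qed
        have "reach_within H' w w r"
          unfolding reach_within_iff_walk using walk_single[of w H'] wV vH' by (intro exI[of _ "[w]"]) simp
        then have ne: "{x. reach_within H' w x r} \<noteq> {}" by blast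
        have "low H' w \<in> rk ` {x. reach_within H' w x r}"
          unfolding low_def using ne reach_fin[OF vH'] by (intro Min_in) auto
        then obtain x where x: "reach_within H' w x r" "low H' w = rk x" by blast
        then have "x \<in> ?V" using vH' by (auto simp: reach_within_iff_walk walk_def)
        then have "rk x \<le> Max (insert 0 (rk ` ?V))" using fin by (intro Max_ge) auto
        then have "Max (insert 0 (rk ` ?V)) - low H' w < Max (insert 0 (rk ` ?V)) - low H v"
          using lower[OF x(1)] x(2) by simp
        then show ?thesis using less.hyps vH' H'(2) wV by blast
      qed
    qed
  qed
  then show ?thesis unfolding flipper_wins_def by blast
qed


section \<open>Graphs of bounded expansion\<close>

text \<open>A subgraph \<open>K_{t,t}\<close> is itself a minor of depth 0, with density
  \<open>2 * t * t / (2 * t) = t\<close>.\<close>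

lemma weakly_sparse_if_bounded_expansion:
  assumes wf: "\<forall>G\<in>C. wf_graph G" and be: "bounded_expansion C"
  shows "weakly_sparse C"
proof -
  obtain c where c: "\<forall>G\<in>C. tnabla 0 G \<le> c" using be unfolding bounded_expansion_def by blast
  obtain t :: nat where t: "max c 0 < real t" using reals_Archimedean2 by blast
  have "\<not> contains_Ktt G t" if G: "G \<in> C" for G
  proof
    assume "contains_Ktt G t"
    then obtain A B where AB: "A \<subseteq> fst G" "B \<subseteq> fst G" "A \<inter> B = {}" "card A = t" "card B = t"
      "\<forall>a\<in>A. \<forall>b\<in>B. adj G a b"
      unfolding contains_Ktt_def by metis
    define F where "F = (\<lambda>(a, b). {a, b}) ` (A \<times> B)"
    have "\<exists>p. \<exists>u v. e = {u, v} \<and> is_path G p u v \<and> length p - 1 \<le> 0 + 1 \<and> set p = e"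
      if "e \<in> F" for e
    proof -
      obtain a b where ab: "a \<in> A" "b \<in> B" "e = {a, b}" using \<open>e \<in> F\<close> by (fastforce simp: F_def)
      then have "walk G [a, b] a b" "a \<noteq> b" using AB by (auto simp: walk_def)
      then show ?thesis using ab by (intro exI[of _ "[a, b]"] exI[of _ a] exI[of _ b]) (simp add: is_path_iff_walk)
    qed
    then obtain P where P: "\<And>e. e \<in> F \<Longrightarrow> \<exists>u v. e = {u, v} \<and> is_path G (P e) u v \<and> length (P e) - 1 \<le> 0 + 1 \<and> set (P e) = e"
      by metis
    have "shallow_top_minor G 0 (A \<union> B) F"
      unfolding shallow_top_minor_def
    proof (intro conjI exI[of _ P] ballI impI)
      fix e assume "e \<in> F"
      then show "e \<subseteq> A \<union> B" "card e = 2" using AB(3) by (auto simp: F_def card_insert_if)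
    next
      fix e assume "e \<in> F"
      then show "\<exists>u v. e = {u, v} \<and> is_path G (P e) u v \<and> length (P e) - 1 \<le> 0 + 1 \<and>
        (set (P e) - e) \<inter> (A \<union> B) = {}" using P[of e] by blast
    next
      fix e e' assume "e \<in> F" "e' \<in> F"
      then show "(set (P e) - e) \<inter> (set (P e') - e') = {}" using P[of e] by blast
    qed (use AB in auto)
    moreover have fin: "finite (fst G)" using wf G by (auto simp: wf_graph_def)
    ultimately have "2 * real (card F) / real (card (A \<union> B)) \<le> c"
      using c G by (meson tnabla_le_iff)
    moreover have "card F = t * t"
    proof -
      have "inj_on (\<lambda>(a, b). {a, b}) (A \<times> B)"
        using AB(3) by (auto simp: inj_on_def doubleton_eq_iff)
      then show ?thesis using AB by (simp add: F_def card_image card_cartesian_product)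
    qed
    moreover have "card (A \<union> B) = 2 * t"
      using AB fin by (subst card_Un_disjoint) (auto intro: finite_subset)
    ultimately have "real t \<le> c" using t by (simp add: field_simps)
    then show False using t by simp
  qed
  then show ?thesis unfolding weakly_sparse_def by blast
qed

text \<open>The average degree is at most \<open>c\<close>, so at least half of \<open>S\<close> has
  degree at most \<open>2 * c\<close>. A maximal independent set \<open>I\<close> of such vertices
  dominates all of them, and each member dominates at most \<open>2 * c + 1\<close>.\<close>

lemma independent_low_degree_subset:
  fixes c :: nat
  assumes fin: "finite S" and F: "\<forall>e\<in>F. e \<subseteq> S \<and> card e = 2" and sparse: "2 * card F \<le> c * card S"
  shows "\<exists>I\<subseteq>S. (\<forall>u\<in>I. \<forall>v\<in>I. {u, v} \<notin> F) \<and> (\<forall>v\<in>I. card {u \<in> S. {u, v} \<in> F} \<le> 2 * c) \<and>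
    card S \<le> 2 * (2 * c + 1) * card I"
proof -
  define nb where "nb = (\<lambda>v. {u \<in> S. {u, v} \<in> F})"
  have finF: "finite F" using fin F by (intro finite_subset[of F "Pow S"]) auto
  have finnb: "finite (nb v)" for v using fin by (simp add: nb_def)
  define L where "L = {v \<in> S. card (nb v) \<le> 2 * c}"
  have "(\<Sum>v\<in>S. card (nb v)) \<le> (\<Sum>v\<in>S. card {e \<in> F. v \<in> e})"
  proof (rule sum_mono)
    fix v
    have "inj_on (\<lambda>u. {u, v}) (nb v)" by (auto simp: inj_on_def doubleton_eq_iff)
    then show "card (nb v) \<le> card {e \<in> F. v \<in> e}"
      by (rule card_inj_on_le) (use finF in \<open>auto simp: nb_def\<close>)
  qed
  also have "\<dots> = 2 * card F"
  proof (rule sum_multicount[OF fin finF], rule ballI)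
    fix e assume "e \<in> F"
    then have "{v \<in> S. v \<in> e} = e" "card e = 2" using F by auto
    then show "card {v \<in> S. v \<in> e} = 2" by simp
  qed
  finally have degsum: "(\<Sum>v\<in>S. card (nb v)) \<le> c * card S" using sparse by simp
  \<comment> \<open>Markov's inequality: every vertex outside \<open>L\<close> contributes at least
    \<open>2 * c + 1\<close> to the degree sum.\<close>
  have "(2 * c + 1) * card (S - L) = (\<Sum>v\<in>S - L. 2 * c + 1)" by simp
  also have "\<dots> \<le> (\<Sum>v\<in>S - L. card (nb v))" by (rule sum_mono) (auto simp: L_def)
  also have "\<dots> \<le> (\<Sum>v\<in>S. card (nb v))" by (rule sum_mono2) (use fin in auto)
  finally have "(2 * c + 1) * card (S - L) \<le> c * card S" using degsum by simp
  moreover have cS: "card S = card L + card (S - L)"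
    using fin card_Un_disjoint[of L "S - L"] by (simp add: L_def Un_absorb1 finite_subset)
  ultimately have "(2 * c + 1) * card (S - L) \<le> c * card L + c * card (S - L)"
    by (simp add: distrib_left)
  then have "(c + 1) * card (S - L) \<le> (c + 1) * card L" by (simp add: algebra_simps)
  then have "card (S - L) \<le> card L" by (metis Suc_eq_plus1 Suc_mult_le_cancel1)
  then have SL: "card S \<le> 2 * card L" using cS by simp
  let ?J = "{I \<in> Pow L. \<forall>u\<in>I. \<forall>v\<in>I. {u, v} \<notin> F}"
  have "finite ?J" using fin by (simp add: L_def)
  moreover have "?J \<noteq> {}" by blast
  ultimately have "\<exists>I\<in>?J. \<forall>J\<in>?J. I \<subseteq> J \<longrightarrow> I = J" by (rule finite_has_maximal)
  then obtain I where I: "I \<in> ?J" and maxI: "\<forall>J\<in>?J. I \<subseteq> J \<longrightarrow> I = J" by (rule bexE)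
  have IS: "I \<subseteq> L" "L \<subseteq> S" using I by (auto simp: L_def)
  have finI: "finite I" using IS fin finite_subset by meson
  have "L \<subseteq> (\<Union>v\<in>I. insert v (nb v))"
  proof
    fix w assume w: "w \<in> L"
    show "w \<in> (\<Union>v\<in>I. insert v (nb v))"
    proof (rule ccontr)
      assume neg: "w \<notin> (\<Union>v\<in>I. insert v (nb v))"
      have no: "{w, v} \<notin> F" "{v, w} \<notin> F" if "v \<in> I" for v
        using neg w that IS by (auto simp: nb_def insert_commute)
      have "{w, w} \<notin> F" using F by fastforce
      then have "insert w I \<in> ?J" using I w no by auto
      then have "I \<subseteq> insert w I \<longrightarrow> I = insert w I" by (rule bspec[OF maxI])
      then have "w \<in> I" by blast
      then show False using neg by blast
    qed
  qed
  then have "card L \<le> card (\<Union>v\<in>I. insert v (nb v))"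
    by (rule card_mono[rotated]) (use finI finnb in auto)
  also have "\<dots> \<le> (\<Sum>v\<in>I. card (insert v (nb v)))" by (rule card_UN_le[OF finI])
  also have "\<dots> \<le> (\<Sum>v\<in>I. 2 * c + 1)"
  proof (rule sum_mono)
    fix v assume "v \<in> I"
    then have "card (nb v) \<le> 2 * c" using IS by (auto simp: L_def)
    then show "card (insert v (nb v)) \<le> 2 * c + 1"
      using card_insert_le_m1 finnb by (simp add: card_insert_if)
  qed
  finally have "card L \<le> (2 * c + 1) * card I" by (simp add: mult.commute)
  then have "card S \<le> 2 * (2 * c + 1) * card I" using SL by simp
  moreover have "\<forall>v\<in>I. card {u \<in> S. {u, v} \<in> F} \<le> 2 * c" using IS by (auto simp: L_def nb_def)
  ultimately show ?thesis using I IS by (intro exI[of _ I]) auto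
qed

text \<open>\<open>F\<close> is a maximal shallow topological minor with branch set \<open>S\<close>, and \<open>M\<close> consists of the inner
  vertices of its paths. If \<open>v\<close> has no small hitting set, then it has many disjoint short paths to
  \<open>M\<close>; by maximality of \<open>F\<close> these paths are disjoint for non-adjacent \<open>v\<close>, so that a large
  independent set \<open>I\<close> of such \<open>v\<close> gives a too dense minor on \<open>I \<union> M\<close>.\<close>
lemma hitting_set_exists:
  fixes c R :: nat
  assumes wf: "wf_graph G"
    and sparse: "\<And>B F. shallow_top_minor G (2 * R) B F \<Longrightarrow> 2 * card F \<le> c * card B"
    and S: "S \<subseteq> fst G" "S \<noteq> {}"
    and q: "q = c * (1 + 2 * R * c * (2 * c + 1))"
  shows "\<exists>v\<in>S. \<exists>X. card X \<le> R * q + 2 * c \<and> X \<subseteq> fst G \<and> v \<notin> X \<and>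
    (\<forall>p u. walk G p v u \<and> u \<in> S - {v} \<and> length p \<le> R + 1 \<longrightarrow> set p \<inter> X \<noteq> {})"
proof -
  have fin: "finite (fst G)" using wf by (simp add: wf_graph_def)
  have finS: "finite S" using S fin finite_subset by meson
  let ?FF = "{F. shallow_top_minor G (2 * R) S F}"
  have "?FF \<subseteq> Pow (Pow S)" by (auto simp: shallow_top_minor_def)
  then have "finite ?FF" by (rule finite_subset) (simp add: finS)
  moreover have "{} \<in> ?FF" using S by (simp add: shallow_top_minor_def)
  then have "?FF \<noteq> {}" by blast
  ultimately have "\<exists>F\<in>?FF. \<forall>F'\<in>?FF. F \<subseteq> F' \<longrightarrow> F = F'" by (rule finite_has_maximal)
  then obtain F where "F \<in> ?FF" "\<forall>F'\<in>?FF. F \<subseteq> F' \<longrightarrow> F = F'" by (rule bexE)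
  then have F: "shallow_top_minor G (2 * R) S F" and
    maxF: "\<And>F'. shallow_top_minor G (2 * R) S F' \<Longrightarrow> F \<subseteq> F' \<Longrightarrow> F = F'"
    by simp_all
  have F2: "\<forall>e\<in>F. e \<subseteq> S \<and> card e = 2" using F by (simp add: shallow_top_minor_def)
  have finF: "finite F" using finS F2 by (intro finite_subset[of F "Pow S"]) auto
  obtain P where P: "\<forall>e\<in>F. \<exists>u v. e = {u, v} \<and> is_path G (P e) u v \<and> length (P e) - 1 \<le> 2 * R + 1
                    \<and> (set (P e) - e) \<inter> S = {}"
    and disj: "\<forall>e\<in>F. \<forall>e'\<in>F. e \<noteq> e' \<longrightarrow> (set (P e) - e) \<inter> (set (P e') - e') = {}"
    using F by (rule shallow_top_minorE)
  define M where "M = (\<Union>e\<in>F. set (P e) - e)"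
  have MS: "M \<inter> S = {}" using P unfolding M_def by blast
  have MG: "M \<subseteq> fst G" using P unfolding M_def is_path_def by blast
  have finM: "finite M" using MG fin finite_subset by meson
  have "card M \<le> (\<Sum>e\<in>F. card (set (P e) - e))" unfolding M_def by (rule card_UN_le[OF finF])
  \<comment> \<open>A path with at most \<open>2 * R + 1\<close> edges has at most
    \<open>2 * R\<close> inner vertices.\<close>
  also have "\<dots> \<le> (\<Sum>e\<in>F. 2 * R)"
  proof (rule sum_mono)
    fix e assume e: "e \<in> F"
    then obtain u v where uv: "e = {u, v}" "is_path G (P e) u v" "length (P e) - 1 \<le> 2 * R + 1"
      using P by (metis (no_types, lifting))
    then have "e \<subseteq> set (P e)" using is_path_ends_in_set by fast
    then have "card (set (P e) - e) = card (set (P e)) - card e"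
      by (intro card_Diff_subset) (auto intro: finite_subset)
    also have "\<dots> = length (P e) - 2" using F2 e uv(2) by (simp add: is_path_def distinct_card)
    finally show "card (set (P e) - e) \<le> 2 * R" using uv(3) by simp
  qed
  finally have cM: "card M \<le> 2 * R * card F" by (simp add: mult.commute)
  \<comment> \<open>Maximality of \<open>F\<close>: otherwise the walk, shortened to a path, could
    be added as a new edge, as its interior avoids the branch set and all other paths.\<close>
  have connect: "{u, v} \<in> F"
    if uv: "u \<in> S" "v \<in> S" "u \<noteq> v" and p: "walk G p u v" "length p \<le> 2 * R + 2"
      "(set p - {u, v}) \<inter> (S \<union> M) = {}" for u v p
  proof (rule ccontr)
    assume new: "{u, v} \<notin> F"
    obtain p' where p': "is_path G p' u v" "set p' \<subseteq> set p" "length p' \<le> length p"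
      using walk_to_path[OF p(1)] by blast
    let ?P = "P({u, v} := p')"
    have inner: "(set p' - {u, v}) \<inter> (S \<union> M) = {}" using p(3) p'(2) by blast
    have "shallow_top_minor G (2 * R) S (insert {u, v} F)"
      unfolding shallow_top_minor_def
    proof (intro conjI exI[of _ ?P] ballI impI)
      show "S \<subseteq> fst G" by fact
    next
      fix e assume "e \<in> insert {u, v} F"
      then show "e \<subseteq> S" "card e = 2" using F2 uv by auto
    next
      fix e assume e: "e \<in> insert {u, v} F"
      show "\<exists>a b. e = {a, b} \<and> is_path G (?P e) a b \<and> length (?P e) - 1 \<le> 2 * R + 1
        \<and> (set (?P e) - e) \<inter> S = {}"
      proof (cases "e = {u, v}")
        case True
        have "length p' - 1 \<le> 2 * R + 1" using p'(3) p(2) by simp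
        then show ?thesis using True p'(1) inner by (intro exI[of _ u] exI[of _ v]) auto
      next
        case False
        then show ?thesis using e P by simp
      qed
    next
      fix e e' assume e: "e \<in> insert {u, v} F" "e' \<in> insert {u, v} F" "e \<noteq> e'"
      have out: "(set p' - {u, v}) \<inter> (set (P f) - f) = {}" if "f \<in> F" for f
        using inner that unfolding M_def by blast
      show "(set (?P e) - e) \<inter> (set (?P e') - e') = {}"
      proof (cases "e = {u, v}")
        case True
        then have "e' \<in> F" "e' \<noteq> {u, v}" using e by auto
        then show ?thesis using True out[of e'] by simp
      next
        case eF: False
        show ?thesis
        proof (cases "e' = {u, v}")
          case True
          then show ?thesis using e eF out[of e] by (simp add: Int_commute)
        next
          case False
          then have "e \<in> F" "e' \<in> F" using e eF by auto
          then show ?thesis using eF False disj e(3) by simp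
        qed
      qed
    qed
    then show False using maxF[of "insert {u, v} F"] new by blast
  qed
  obtain I where I: "I \<subseteq> S" "\<forall>u\<in>I. \<forall>v\<in>I. {u, v} \<notin> F" "\<forall>v\<in>I. card {u \<in> S. {u, v} \<in> F} \<le> 2 * c"
    "card S \<le> 2 * (2 * c + 1) * card I"
    using independent_low_degree_subset[OF finS F2 sparse[OF F]] by blast
  have finI: "finite I" using I(1) finS finite_subset by meson
  \<comment> \<open>A fan consists of paths with at most \<open>R\<close> edges from
    \<open>v\<close> to its set of ends \<open>N\<close>, disjoint except at \<open>v\<close>. For
    every \<open>v\<close> one with an inclusion-maximal set of ends is fixed.\<close>
  define fan where "fan = (\<lambda>v N Q. N \<subseteq> M \<and>
    (\<forall>m\<in>N. is_path G (Q m) v m \<and> length (Q m) \<le> R + 1 \<and> (set (Q m) - {v, m}) \<inter> (S \<union> M) = {}) \<and>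
    (\<forall>m\<in>N. \<forall>m'\<in>N. m \<noteq> m' \<longrightarrow> set (Q m) \<inter> set (Q m') \<subseteq> {v}))"
  have "\<exists>N Q. fan v N Q \<and> (\<forall>N' Q'. fan v N' Q' \<and> N \<subseteq> N' \<longrightarrow> N = N')" for v
  proof -
    let ?NN = "{N. \<exists>Q. fan v N Q}"
    have "?NN \<subseteq> Pow M" by (auto simp: fan_def)
    then have "finite ?NN" by (rule finite_subset) (simp add: finM)
    moreover have "{} \<in> ?NN" by (simp add: fan_def)
    then have "?NN \<noteq> {}" by blast
    ultimately have "\<exists>N\<in>?NN. \<forall>N'\<in>?NN. N \<subseteq> N' \<longrightarrow> N = N'" by (rule finite_has_maximal)
    then show ?thesis by auto
  qed
  then obtain N Q where fanNQ: "\<And>v. fan v (N v) (Q v)" and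
    maxN: "\<And>v N' Q'. fan v N' Q' \<Longrightarrow> N v \<subseteq> N' \<Longrightarrow> N v = N'"
    by metis
  have NM: "N v \<subseteq> M" for v using fanNQ[of v] unfolding fan_def by (elim conjE)
  have finN: "finite (N v)" for v using NM finM by (rule finite_subset)
  have fan1: "is_path G (Q v m) v m" "length (Q v m) \<le> R + 1" "(set (Q v m) - {v, m}) \<inter> (S \<union> M) = {}"
    if "m \<in> N v" for v m
    using fanNQ[of v] that unfolding fan_def by blast+
  have fan2: "set (Q v m) \<inter> set (Q v m') \<subseteq> {v}" if "m \<in> N v" "m' \<in> N v" "m \<noteq> m'" for v m m'
    using fanNQ[of v] that unfolding fan_def by blast
  show ?thesis
  proof (cases "\<exists>v\<in>I. card (N v) \<le> q")
    case True
    then obtain v where v: "v \<in> I" "card (N v) \<le> q" by blast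
    have vS: "v \<in> S" using v I by blast
    \<comment> \<open>A small maximal fan yields the hitting set: at most \<open>R\<close> vertices
      from each fan path, and at most \<open>2 * c\<close> neighbours of \<open>v\<close> in
      \<open>F\<close>.\<close>
    define X where "X = (\<Union>m\<in>N v. set (Q v m) - {v}) \<union> {u \<in> S. {u, v} \<in> F}"
    have "card (\<Union>m\<in>N v. set (Q v m) - {v}) \<le> (\<Sum>m\<in>N v. card (set (Q v m) - {v}))"
      by (rule card_UN_le[OF finN])
    also have "\<dots> \<le> (\<Sum>m\<in>N v. R)"
    proof (rule sum_mono)
      fix m assume m: "m \<in> N v"
      have "v \<in> set (Q v m)" using fan1(1)[OF m] by (rule is_path_ends_in_set)
      then have "card (set (Q v m) - {v}) = card (set (Q v m)) - 1" by simp
      then show "card (set (Q v m) - {v}) \<le> R"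
        using card_length[of "Q v m"] fan1(2)[OF m] by linarith
    qed
    also have "\<dots> \<le> R * q" using v(2) by simp
    finally have "card X \<le> R * q + 2 * c"
      unfolding X_def using I(3) v(1) card_Un_le by (meson add_mono order_trans)
    moreover have "X \<subseteq> fst G"
      unfolding X_def using fan1(1) S(1) by (auto simp: is_path_def)
    moreover have "{v, v} \<notin> F" using F2 by fastforce
    then have "v \<notin> X" by (simp add: X_def)
    moreover have "set p \<inter> X \<noteq> {}" if "walk G p v u" "u \<in> S - {v}" "length p \<le> R + 1" for p u
    proof
      assume avoid: "set p \<inter> X = {}"
      obtain p' where p': "is_path G p' v u" "set p' \<subseteq> set p" "length p' \<le> length p"
        using walk_to_path[OF \<open>walk G p v u\<close>] by blast
      obtain t where t: "p' = v # t" using p'(1) by (cases p') (auto simp: is_path_def)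
      have "u \<in> set t" using is_path_ends_in_set(2)[OF p'(1)] t \<open>u \<in> S - {v}\<close> by simp
      \<comment> \<open>Consider the first vertex \<open>x\<close> after \<open>v\<close> in
        \<open>S \<union> M\<close>. If it is in \<open>S\<close>, \<open>connect\<close> makes it a
        neighbour of \<open>v\<close> in \<open>F\<close>; if it is in \<open>M\<close>, the initial
        segment would enlarge the maximal fan.\<close>
      then have "\<exists>x\<in>set t. x \<in> S \<union> M" using \<open>u \<in> S - {v}\<close> by blast
      then obtain ys x zs where d: "t = ys @ x # zs" "x \<in> S \<union> M" "\<forall>y\<in>set ys. y \<notin> S \<union> M"
        by (rule split_list_first_propE)
      let ?p = "v # ys @ [x]"
      have "walk G ((v # ys) @ x # zs) v u" "distinct p'" using p'(1) t d(1) by (simp_all add: is_path_iff_walk)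
      then have wk: "walk G ?p v x" using walk_prefix by fastforce
      then have path: "is_path G ?p v x" using \<open>distinct p'\<close> t d(1) by (simp add: is_path_iff_walk)
      have len: "length ?p \<le> R + 1" using p'(3) t d(1) \<open>length p \<le> R + 1\<close> by simp
      have sub: "set ?p \<subseteq> set p" using p'(2) t d(1) by auto
      have xv: "x \<noteq> v" using \<open>distinct p'\<close> t d(1) by auto
      have inner: "(set ?p - {v, x}) \<inter> (S \<union> M) = {}" using d(3) by auto
      show False
      proof (cases "x \<in> S")
        case True
        have "{v, x} \<in> F" using connect[OF vS True _ wk _ inner] xv len by simp
        then have "x \<in> X" using True by (simp add: X_def insert_commute)
        then show False using avoid sub by auto
      next
        case False
        then have xM: "x \<in> M" using d(2) by blast
        have "x \<notin> N v"
        proof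
          assume x: "x \<in> N v"
          have "x \<in> set (Q v x)" using fan1(1)[OF x] by (rule is_path_ends_in_set)
          then have "x \<in> X" using x xv by (auto simp: X_def)
          then show False using avoid sub by auto
        qed
        have meet: "set ?p \<inter> set (Q v m) \<subseteq> {v}" if "m \<in> N v" for m
          using avoid sub that unfolding X_def by blast
        have "fan v (insert x (N v)) ((Q v)(x := ?p))"
          unfolding fan_def
        proof (intro conjI ballI impI)
          show "insert x (N v) \<subseteq> M" using xM NM by blast
        next
          fix m assume m: "m \<in> insert x (N v)"
          show "is_path G (((Q v)(x := ?p)) m) v m" "length (((Q v)(x := ?p)) m) \<le> R + 1"
            "(set (((Q v)(x := ?p)) m) - {v, m}) \<inter> (S \<union> M) = {}"
            using m path len inner fan1[of m v] by (auto simp del: set_append)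
        next
          fix m m' assume m: "m \<in> insert x (N v)" "m' \<in> insert x (N v)" "m \<noteq> m'"
          show "set (((Q v)(x := ?p)) m) \<inter> set (((Q v)(x := ?p)) m') \<subseteq> {v}"
          proof (cases "m = x")
            case True
            then show ?thesis using m meet[of m'] by simp
          next
            case mx: False
            show ?thesis
            proof (cases "m' = x")
              case True
              then show ?thesis using m mx meet[of m] by (simp add: Int_commute)
            next
              case False
              then show ?thesis using m mx fan2[of m v m'] by simp
            qed
          qed
        qed
        then show False using maxN \<open>x \<notin> N v\<close> by blast
      qed
    qed
    ultimately show ?thesis using vS by blast
  next
    case False
    define pr :: "'a \<times> 'a \<Rightarrow> 'a set" where "pr = (\<lambda>(v, m). {v, m})"
    define F' where "F' = pr ` (Sigma I N)"
    have vm: "v \<in> S" "v \<notin> M" "m \<in> M" "m \<notin> S" "v \<noteq> m" if "v \<in> I" "m \<in> N v" for v m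
      using that I(1) NM MS by blast+
    have inj: "inj_on pr (Sigma I N)"
    proof (rule inj_onI, clarify)
      fix v m v' m' assume *: "v \<in> I" "m \<in> N v" "v' \<in> I" "m' \<in> N v'" "pr (v, m) = pr (v', m')"
      then show "v = v' \<and> m = m'"
        using vm[of v m] vm[of v' m'] by (auto simp: pr_def doubleton_eq_iff)
    qed
    \<comment> \<open>An edge determines its centre and its end, because centres lie in
      \<open>S\<close>, ends in \<open>M\<close>, and these sets are disjoint.\<close>
    define P' where "P' = (\<lambda>e. case inv_into (Sigma I N) pr e of (v, m) \<Rightarrow> Q v m)"
    have P': "P' {v, m} = Q v m" if "v \<in> I" "m \<in> N v" for v m
      using inv_into_f_f[OF inj, of "(v, m)"] that by (simp add: P'_def pr_def)
    have F'E: "\<exists>v m. v \<in> I \<and> m \<in> N v \<and> e = {v, m}" if "e \<in> F'" for e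
      using that by (auto simp: F'_def pr_def)
    have "shallow_top_minor G (2 * R) (I \<union> M) F'"
      unfolding shallow_top_minor_def
    proof (intro conjI exI[of _ P'] ballI impI)
      show "I \<union> M \<subseteq> fst G" using I(1) S(1) MG by blast
    next
      fix e assume "e \<in> F'"
      then obtain v m where e: "v \<in> I" "m \<in> N v" "e = {v, m}" using F'E by blast
      then show "e \<subseteq> I \<union> M" "card e = 2" using vm[OF e(1,2)] by auto
      have "length (Q v m) - 1 \<le> 2 * R + 1" using fan1(2)[OF e(2)] by simp
      moreover have "(set (Q v m) - {v, m}) \<inter> (I \<union> M) = {}" using fan1(3)[OF e(2)] I(1) by blast
      ultimately show "\<exists>a b. e = {a, b} \<and> is_path G (P' e) a b \<and> length (P' e) - 1 \<le> 2 * R + 1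
        \<and> (set (P' e) - e) \<inter> (I \<union> M) = {}"
        using P'[OF e(1,2)] fan1(1)[OF e(2)] e(3) by (intro exI[of _ v] exI[of _ m]) simp
    next
      fix e e' assume ee: "e \<in> F'" "e' \<in> F'" "e \<noteq> e'"
      obtain v m where e: "v \<in> I" "m \<in> N v" "e = {v, m}" using F'E ee by blast
      obtain v' m' where e': "v' \<in> I" "m' \<in> N v'" "e' = {v', m'}" using F'E ee by blast
      have "(set (Q v m) - {v, m}) \<inter> (set (Q v' m') - {v', m'}) = {}"
      proof (cases "v = v'")
        case True
        then have "set (Q v m) \<inter> set (Q v' m') \<subseteq> {v}" using fan2[of m v m'] e e' ee(3) by blast
        then show ?thesis by blast
      next
        case False
        show ?thesis
        \<comment> \<open>If fan paths of distinct centres crossed in \<open>x\<close>, their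
          initial segments would form a short walk from \<open>v\<close> to \<open>v'\<close>
          avoiding \<open>S \<union> M\<close> inside. By \<open>connect\<close>, two vertices of
          the independent set \<open>I\<close> would be adjacent in \<open>F\<close>.\<close>
        proof (rule ccontr)
          assume "\<not> ?thesis"
          then obtain x where x: "x \<in> set (Q v m)" "x \<noteq> v" "x \<noteq> m" "x \<in> set (Q v' m')" "x \<noteq> v'" "x \<noteq> m'"
            by blast
          have initial: "\<exists>us. walk G (us @ [x]) a x \<and> length us \<le> R \<and> set us \<subseteq> set (Q a b) - {b}"
            if ab: "b \<in> N a" "x \<in> set (Q a b)" "x \<noteq> b" for a b
          proof -
            obtain us vs where d: "Q a b = us @ x # vs" using ab(2) by (meson split_list)
            have path: "walk G (us @ x # vs) a b" "distinct (us @ x # vs)"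
              using fan1(1)[OF ab(1)] d by (simp_all add: is_path_iff_walk)
            have "b = last (x # vs)" using path(1) by (simp add: walk_def)
            then have "b \<in> set (x # vs)" by (metis last_in_set list.distinct(1))
            then have "set us \<subseteq> set (Q a b) - {b}" using path(2) d by auto
            moreover have "length us \<le> R" using fan1(2)[OF ab(1)] d by simp
            ultimately show ?thesis using walk_prefix[OF path(1)] by blast
          qed
          obtain us where us: "walk G (us @ [x]) v x" "length us \<le> R" "set us \<subseteq> set (Q v m) - {m}"
            using initial[OF e(2) x(1,3)] by blast
          obtain us' where us': "walk G (us' @ [x]) v' x" "length us' \<le> R" "set us' \<subseteq> set (Q v' m') - {m'}"
            using initial[OF e'(2) x(4,6)] by blast
          have wk: "walk G ((us @ [x]) @ tl (rev (us' @ [x]))) v v'"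
            by (rule walk_append[OF us(1) walk_rev[OF us'(1)]])
          have "x \<notin> S \<union> M" using fan1(3)[OF e(2)] x by blast
          moreover have "(set us - {v}) \<inter> (S \<union> M) = {}" using us(3) fan1(3)[OF e(2)] by blast
          moreover have "(set us' - {v'}) \<inter> (S \<union> M) = {}" using us'(3) fan1(3)[OF e'(2)] by blast
          ultimately have "(set ((us @ [x]) @ tl (rev (us' @ [x]))) - {v, v'}) \<inter> (S \<union> M) = {}"
            by auto
          moreover have "length ((us @ [x]) @ tl (rev (us' @ [x]))) \<le> 2 * R + 2"
            using us(2) us'(2) by simp
          ultimately have "{v, v'} \<in> F"
            using connect[OF _ _ False wk] vm(1)[OF e(1,2)] vm(1)[OF e'(1,2)] by blast
          then show False using I(2) e(1) e'(1) by blast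
        qed
      qed
      then show "(set (P' e) - e) \<inter> (set (P' e') - e') = {}"
        using e(3) e'(3) P'[OF e(1,2)] P'[OF e'(1,2)] by simp
    qed
    then have "2 * card F' \<le> c * card (I \<union> M)" by (rule sparse)
    also have "\<dots> \<le> c * (card I + card M)" by (intro mult_le_mono2 card_Un_le)
    also have "\<dots> \<le> q * card I"
    proof -
      \<comment> \<open>The sizes of \<open>M\<close>, \<open>F\<close> and \<open>S\<close> are
        each bounded by a constant times the next, and that of \<open>S\<close> by a constant times
        \<open>card I\<close>; \<open>q\<close> is chosen so as to absorb these factors.\<close>
      have "card M \<le> R * (2 * card F)" using cM by simp
      also have "\<dots> \<le> R * (c * card S)" using sparse[OF F] by (rule mult_le_mono2)
      also have "\<dots> \<le> R * (c * (2 * (2 * c + 1) * card I))" using I(4) by (intro mult_le_mono2)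
      finally have "card I + card M \<le> (1 + 2 * R * c * (2 * c + 1)) * card I"
        by (simp add: algebra_simps)
      then have "c * (card I + card M) \<le> c * ((1 + 2 * R * c * (2 * c + 1)) * card I)"
        by (rule mult_le_mono2)
      then show ?thesis by (simp only: q mult.assoc)
    qed
    finally have up: "2 * card F' \<le> q * card I" .
    have "card S > 0" using S(2) finS by (simp add: card_gt_0_iff)
    then have "card I > 0" using I(4) by (cases "card I") auto
    \<comment> \<open>Now every fan has more than \<open>q\<close> ends, which makes
      \<open>F'\<close> too large for the bound \<open>up\<close>.\<close>
    have "(q + 1) * card I = (\<Sum>v\<in>I. q + 1)" by simp
    also have "\<dots> \<le> (\<Sum>v\<in>I. card (N v))" by (rule sum_mono) (use False in auto)
    also have "\<dots> = card F'"
      unfolding F'_def card_image[OF inj]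
      by (rule card_SigmaI[symmetric]) (simp_all add: finI finN)
    finally have "(q + 1) * card I \<le> card F'" .
    then have False using up \<open>card I > 0\<close> by (simp add: algebra_simps)
    then show ?thesis ..
  qed
qed

lemma bounded_flip_width_if_bounded_expansion:
  assumes wf: "\<forall>G\<in>C. wf_graph G" and be: "bounded_expansion C"
  shows "bounded_flip_width C"
  unfolding bounded_flip_width_def
proof
  fix r
  \<comment> \<open>Two successive moves form walks with up to \<open>2 * r\<close> edges, so
    \<open>hitting_set_exists\<close> is applied with \<open>R = 2 * r\<close>, which involves
    minors of depth \<open>2 * R\<close>.\<close>
  obtain c' where c': "\<forall>G\<in>C. tnabla (2 * (2 * r)) G \<le> c'"
    using be unfolding bounded_expansion_def by blast
  obtain c :: nat where c: "c' \<le> real c" using real_arch_simple by blast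
  define q where "q = c * (1 + 2 * (2 * r) * c * (2 * c + 1))"
  define K where "K = 2 * r * q + 2 * c"
  have "flip_width r G \<le> Suc K ^ Suc r + 2 ^ (Suc K ^ Suc r)" if G: "G \<in> C" for G
  proof -
    have wfG: "wf_graph G" and fin: "finite (fst G)" using wf G by (auto simp: wf_graph_def)
    have sparse: "2 * card F \<le> c * card B" if BF: "shallow_top_minor G (2 * (2 * r)) B F" for B F
    proof (cases "card B = 0")
      case True
      then have "B = {}" using BF fin by (auto simp: shallow_top_minor_def finite_subset)
      then have "F = {}" using BF by (auto simp: shallow_top_minor_def)
      then show ?thesis by simp
    next
      case False
      have "2 * real (card F) / real (card B) \<le> c'"
        using c' G BF tnabla_le_iff[OF fin] by blast
      then have "2 * real (card F) / real (card B) \<le> real c" using c by linarith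
      then have "real (2 * card F) \<le> real (c * card B)" using False by (simp add: field_simps)
      then show ?thesis by (simp only: of_nat_le_iff)
    qed
    let ?Q = "\<lambda>S v. \<exists>X. card X \<le> K \<and> X \<subseteq> fst G \<and> v \<notin> X \<and>
      (\<forall>p u. walk G p v u \<and> u \<in> S - {v} \<and> length p \<le> 2 * r + 1 \<longrightarrow> set p \<inter> X \<noteq> {})"
    have "\<exists>rk :: 'a \<Rightarrow> nat. inj_on rk (fst G) \<and> (\<forall>v\<in>fst G. ?Q {u \<in> fst G. rk u \<le> rk v} v)"
      by (rule ranking_by_minimal_choice[OF fin])
         (use hitting_set_exists[OF wfG sparse _ _ q_def] K_def in blast)
    then obtain rk :: "'a \<Rightarrow> nat" where rk: "inj_on rk (fst G)"
      "\<forall>v\<in>fst G. ?Q {u \<in> fst G. rk u \<le> rk v} v" by blast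
    from bchoice[OF rk(2)] obtain X where X: "\<forall>v\<in>fst G. card (X v) \<le> K \<and> X v \<subseteq> fst G \<and> v \<notin> X v \<and>
      (\<forall>p u. walk G p v u \<and> u \<in> {u \<in> fst G. rk u \<le> rk v} - {v} \<and> length p \<le> 2 * r + 1 \<longrightarrow> set p \<inter> X v \<noteq> {})"
      by blast
    have "flipper_wins G r (Suc K ^ Suc r + 2 ^ (Suc K ^ Suc r))"
    proof (rule flipper_wins_if_hitting_sets[OF wfG rk(1), of X])
      show "\<forall>v\<in>fst G. finite (X v) \<and> card (X v) \<le> K \<and> X v \<subseteq> fst G \<and> v \<notin> X v"
        using X fin finite_subset by meson
    next
      fix v u p assume *: "walk G p v u" "length p \<le> 2 * r + 1" "rk u < rk v"
      then have "v \<in> fst G" "u \<in> {u \<in> fst G. rk u \<le> rk v} - {v}" by (auto simp: walk_def)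
      then show "set p \<inter> X v \<noteq> {}" using X * by blast
    qed
    then show ?thesis by (simp only: flip_width_le_iff[OF fin])
  qed
  then show "\<exists>c. \<forall>G\<in>C. flip_width r G \<le> c" by blast
qed

theorem mainTheorem8:
  fixes C :: "'a graph set"
  assumes "\<forall>G\<in>C. wf_graph G"
  shows "bounded_expansion C \<longleftrightarrow> weakly_sparse C \<and> bounded_flip_width C"
  using assms weakly_sparse_if_bounded_expansion bounded_flip_width_if_bounded_expansion
    bounded_expansion_if_bounded_flip_width by metis

end
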